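(* Let $H$ be a complex Hilbert space, let $T$ be a closed (possibly unbounded) linear operator in $H$ with domain $D(T)$, and let $M$ and $N$ be (possibly unbounded) normal operators in $H$ with domains $D(M)$ and $D(N)$ respectively. If $D(N)\subset D(T)$, then $TN\subset MT$ implies $TN^*\subset M^*T$.
   Context: A densely defined closed operator $N$ is normal if $NN^*=N^*N$ (including equality of domains). For linear operators $S,R$, the product $SR$ is defined on $D(SR)=\{x\in D(R): Rx\in D(S)\}$ by $(SR)x=S(Rx)$. For operators $S_1,S_2$, $S_1\subset S_2$ means $D(S_1)\subset D(S_2)$ and $S_2x=S_1x$ for all $x\in D(S_1)$. *)

theory Defs
  imports "HOL-Analysis.Analysis"
begin

class complex_inner = real_normed_vector +
  fixes scaleC :: "complex \<Rightarrow> 'a \<Rightarrow> 'a"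
    and cinner :: "'a \<Rightarrow> 'a \<Rightarrow> complex"
  assumes scaleC_add_right: "scaleC a (x + y) = scaleC a x + scaleC a y"
    and scaleC_add_left: "scaleC (a + b) x = scaleC a x + scaleC b x"
    and scaleC_scaleC: "scaleC a (scaleC b x) = scaleC (a * b) x"
    and scaleC_one: "scaleC 1 x = x"
    and scaleR_scaleC: "scaleR r x = scaleC (complex_of_real r) x"
    and cinner_cnj: "cinner x y = cnj (cinner y x)"
    and cinner_add_right: "cinner x (y + z) = cinner x y + cinner x z"
    and cinner_scaleC_right: "cinner x (scaleC a y) = a * cinner x y"
    and cinner_self_real: "Im (cinner x x) = 0"
    and cinner_self_nonneg: "0 \<le> Re (cinner x x)"
    and cinner_eq_zero_iff: "cinner x x = 0 \<longleftrightarrow> x = 0"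
    and norm_eq_sqrt_cinner: "norm x = sqrt (Re (cinner x x))"

class chilbert_space = complex_inner + complete_space

text \<open>An operator in \<open>H\<close> is a pair of its domain and its action; values outside
  the domain are irrelevant.\<close>

type_synonym 'a lop = "'a set \<times> ('a \<Rightarrow> 'a)"

definition opdom :: "'a lop \<Rightarrow> 'a set" where "opdom T = fst T"
definition opapp :: "'a lop \<Rightarrow> 'a \<Rightarrow> 'a" where "opapp T = snd T"

definition csubspace :: "'a::complex_inner set \<Rightarrow> bool" where
  "csubspace S \<longleftrightarrow> 0 \<in> S \<and> (\<forall>x\<in>S. \<forall>y\<in>S. x + y \<in> S) \<and> (\<forall>c. \<forall>x\<in>S. scaleC c x \<in> S)"

definition linear_op :: "'a::complex_inner lop \<Rightarrow> bool" where
  "linear_op T \<longleftrightarrow> csubspace (opdom T)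
     \<and> (\<forall>x\<in>opdom T. \<forall>y\<in>opdom T. opapp T (x + y) = opapp T x + opapp T y)
     \<and> (\<forall>c. \<forall>x\<in>opdom T. opapp T (scaleC c x) = scaleC c (opapp T x))"

definition graph :: "'a lop \<Rightarrow> ('a \<times> 'a) set" where
  "graph T = {(x, opapp T x) | x. x \<in> opdom T}"

definition closed_op :: "'a::complex_inner lop \<Rightarrow> bool" where
  "closed_op T \<longleftrightarrow> linear_op T \<and> closed (graph T)"

definition densely_defined :: "'a::complex_inner lop \<Rightarrow> bool" where
  "densely_defined T \<longleftrightarrow> closure (opdom T) = UNIV"

definition op_adjoint :: "'a::complex_inner lop \<Rightarrow> 'a lop" where
  "op_adjoint T =
    ({y. \<exists>z. \<forall>x\<in>opdom T. cinner (opapp T x) y = cinner x z},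
     \<lambda>y. THE z. \<forall>x\<in>opdom T. cinner (opapp T x) y = cinner x z)"

definition op_comp :: "'a lop \<Rightarrow> 'a lop \<Rightarrow> 'a lop" where
  "op_comp S R = ({x \<in> opdom R. opapp R x \<in> opdom S}, \<lambda>x. opapp S (opapp R x))"

definition op_le :: "'a lop \<Rightarrow> 'a lop \<Rightarrow> bool" where
  "op_le S1 S2 \<longleftrightarrow> opdom S1 \<subseteq> opdom S2 \<and> (\<forall>x\<in>opdom S1. opapp S2 x = opapp S1 x)"

definition normal_op :: "'a::complex_inner lop \<Rightarrow> bool" where
  "normal_op N \<longleftrightarrow> densely_defined N \<and> closed_op N
     \<and> op_le (op_comp N (op_adjoint N)) (op_comp (op_adjoint N) N)
     \<and> op_le (op_comp (op_adjoint N) N) (op_comp N (op_adjoint N))"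

end

theory Submission
  imports Defs "HOL-Complex_Analysis.Complex_Analysis"
begin

text \<open>
  Resolvents \<open>R e = (1 + e N\<^sup>* N)\<^sup>-\<^sup>1\<close> are contractions commuting with \<open>N\<close> and \<open>N\<^sup>*\<close>. The infinite
  products \<open>Q i = \<Prod>j\<ge>i. R (e j)\<close> with \<open>e j = (j + 1) powr (- 3/2)\<close> tend to the identity, and
  vectors in their ranges are entire for \<open>N\<close>; this replaces the spectral theorem. On such vectors
  Rosenblum's argument with Liouville's theorem gives \<open>T N\<^sup>* = M\<^sup>* T\<close>. Here \<open>T\<close> is bounded relative to
  \<open>N\<close> by the closed graph theorem, so the relation extends to resolvents, hence \<open>T Q i = Q i T\<close>
  on \<open>D(N)\<close>.

  Since \<open>D(N)\<close> need not be a core for \<open>T\<close>, the passage from \<open>T Q i N\<^sup>* x\<close> to \<open>T N\<^sup>* x\<close> needs the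
  hypothesis once more: \<open>N\<close> and \<open>N\<^sup>*\<close> have the same range, so \<open>N\<^sup>* x = N y\<close> with \<open>y\<close> in \<open>D(T N)\<close>, and
  \<open>T Q i N y = M T Q i y = Q i M T y\<close> converges to \<open>M T y = T N y\<close>.
\<close>

section \<open>Complex inner product spaces\<close>

text \<open>Vectors \<open>T x\<close> with \<open>x\<close> in the core of \<open>N\<close> are not
  known to lie in the core of \<open>M\<close>, the space on which all rules for \<open>M\<close>
  and its adjoint are available. Rosenblum's argument therefore runs on the sesquilinear form
  \<open>cinner (T x) y\<close> with \<open>y\<close> in the core of \<open>M\<close>: powers of
  \<open>M\<close> and of its adjoint fall on \<open>y\<close>, and the weak identity obtained
  becomes an operator identity by approximating arbitrary \<open>y\<close> in the domain of
  \<open>M\<close>. Isometry of the exponentials alone would not bound the entire function, because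
  \<open>T\<close> is unbounded. They also commute with \<open>N\<close>, hence preserve
  \<open>norm x + norm (N x)\<close>, the norm in which \<open>T\<close> is bounded. The resolvents
  of \<open>N\<close> and \<open>M\<close> can be compared only after this, since
  \<open>1 + e N* N\<close> contains the adjoint.\<close>

lemma cinner_add_left: "cinner (x + y) z = cinner x z + cinner y z"
  for x :: "'a::complex_inner"
  by (metis cinner_add_right cinner_cnj complex_cnj_add)

lemma cinner_scaleC_left: "cinner (scaleC c x) y = cnj c * cinner x y"
  for x :: "'a::complex_inner"
  by (metis cinner_scaleC_right cinner_cnj complex_cnj_mult)

lemma cinner_scaleR_right: "cinner x (r *\<^sub>R y) = r *\<^sub>R cinner x y"
  for x :: "'a::complex_inner"
  by (simp add: scaleR_scaleC cinner_scaleC_right scaleR_conv_of_real)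

lemma cinner_scaleR_left: "cinner (r *\<^sub>R x) y = r *\<^sub>R cinner x y"
  for x :: "'a::complex_inner"
  by (simp add: scaleR_scaleC cinner_scaleC_left scaleR_conv_of_real)

lemma cinner_zero_right [simp]: "cinner x 0 = 0" for x :: "'a::complex_inner"
  using cinner_scaleR_right[of x 0 0] by simp

lemma cinner_zero_left [simp]: "cinner 0 x = 0" for x :: "'a::complex_inner"
  using cinner_scaleR_left[of 0 0 x] by simp

lemma cinner_minus_right: "cinner x (- y) = - cinner x y" for x :: "'a::complex_inner"
  using cinner_scaleR_right[of x "-1" y] by simp

lemma cinner_minus_left: "cinner (- x) y = - cinner x y" for x :: "'a::complex_inner"
  using cinner_scaleR_left[of "-1" x y] by simp

lemma cinner_diff_right: "cinner x (y - z) = cinner x y - cinner x z" for x :: "'a::complex_inner"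
  using cinner_add_right[of x y "- z"] by (simp add: cinner_minus_right)

lemma cinner_diff_left: "cinner (x - y) z = cinner x z - cinner y z" for x :: "'a::complex_inner"
  using cinner_add_left[of x "- y" z] by (simp add: cinner_minus_left)

lemma Re_cinner_self: "Re (cinner x x) = (norm x)\<^sup>2" for x :: "'a::complex_inner"
  by (simp add: norm_eq_sqrt_cinner cinner_self_nonneg)

lemma cinner_self: "cinner x x = complex_of_real ((norm x)\<^sup>2)" for x :: "'a::complex_inner"
  by (simp add: complex_eq_iff Re_cinner_self cinner_self_real)

lemma Re_cinner_commute: "Re (cinner x y) = Re (cinner y x)" for x :: "'a::complex_inner"
  by (subst cinner_cnj) simp

lemma norm_scaleC: "norm (scaleC c x) = norm c * norm x" for x :: "'a::complex_inner"
proof -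
  have "cinner (scaleC c x) (scaleC c x) = (c * cnj c) * cinner x x"
    by (simp only: cinner_scaleC_left cinner_scaleC_right mult_ac)
  also have "\<dots> = complex_of_real ((norm c * norm x)\<^sup>2)"
    by (simp only: complex_norm_square[symmetric] cinner_self power_mult_distrib of_real_mult of_real_power)
  finally have "cinner (scaleC c x) (scaleC c x) = complex_of_real ((norm c * norm x)\<^sup>2)" .
  then have "(norm (scaleC c x))\<^sup>2 = (norm c * norm x)\<^sup>2"
    by (metis Re_cinner_self Re_complex_of_real)
  then show ?thesis by simp
qed

lemma norm_add_squared: "(norm (x + y))\<^sup>2 = (norm x)\<^sup>2 + (norm y)\<^sup>2 + 2 * Re (cinner x y)"
  for x :: "'a::complex_inner"
  using Re_cinner_commute[of x y]
  by (simp add: cinner_add_left cinner_add_right flip: Re_cinner_self)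

lemma norm_diff_squared: "(norm (x - y))\<^sup>2 = (norm x)\<^sup>2 + (norm y)\<^sup>2 - 2 * Re (cinner x y)"
  for x :: "'a::complex_inner"
  using norm_add_squared[of x "- y"] by (simp add: cinner_minus_right)

lemma parallelogram:
  "(norm (x + y))\<^sup>2 + (norm (x - y))\<^sup>2 = 2 * (norm x)\<^sup>2 + 2 * (norm y)\<^sup>2"
  for x :: "'a::complex_inner"
  by (simp add: norm_add_squared norm_diff_squared)

lemma cauchy_schwarz: "norm (cinner x y) \<le> norm x * norm y" for x :: "'a::complex_inner"
proof (cases "x = 0")
  case False
  \<comment> \<open>Coefficient of the projection of \<open>y\<close> onto the line through
    \<open>x\<close>; Pythagoras gives the rest.\<close>
  define c where "c = cinner x y / complex_of_real ((norm x)\<^sup>2)"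
  have nz: "complex_of_real ((norm x)\<^sup>2) \<noteq> 0" using False by simp
  have "cinner x (y - scaleC c x) = 0"
    using nz by (simp add: cinner_diff_right cinner_scaleC_right cinner_self c_def)
  then have "cinner (scaleC c x) (y - scaleC c x) = 0"
    by (simp add: cinner_scaleC_left)
  then have "(norm y)\<^sup>2 = (norm (scaleC c x))\<^sup>2 + (norm (y - scaleC c x))\<^sup>2"
    using norm_add_squared[of "scaleC c x" "y - scaleC c x"] by simp
  then have "(norm (scaleC c x))\<^sup>2 \<le> (norm y)\<^sup>2" by simp
  then have "norm c * norm x \<le> norm y"
    by (simp add: norm_scaleC)
  then have "norm x * (norm c * norm x) \<le> norm x * norm y"
    by (rule mult_left_mono) simp
  moreover have "norm x * (norm c * norm x) = norm (cinner x y)"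
    using False by (simp add: c_def norm_divide norm_mult power2_eq_square)
  ultimately show ?thesis by simp
qed simp

lemma bounded_bilinear_cinner: "bounded_bilinear (cinner :: 'a::complex_inner \<Rightarrow> 'a \<Rightarrow> complex)"
  by (rule bounded_bilinear.intro)
     (auto simp: cinner_add_left cinner_add_right cinner_scaleR_left cinner_scaleR_right
       intro!: exI[of _ 1] cauchy_schwarz)

lemmas tendsto_cinner = bounded_bilinear.tendsto[OF bounded_bilinear_cinner]

lemma bounded_linear_scaleC: "bounded_linear (scaleC c :: 'a::complex_inner \<Rightarrow> 'a)"
  by (rule bounded_linear_intro[of _ "norm c"])
     (auto simp: scaleC_add_right scaleR_scaleC scaleC_scaleC norm_scaleC mult.commute)

lemma scaleC_minus1: "scaleC (-1) x = - x" for x :: "'a::complex_inner"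
  using scaleR_scaleC[of "-1" x] by simp

lemma csubspaceD:
  assumes "csubspace S"
  shows "0 \<in> S" "x \<in> S \<Longrightarrow> y \<in> S \<Longrightarrow> x + y \<in> S" "x \<in> S \<Longrightarrow> scaleC c x \<in> S"
    "x \<in> S \<Longrightarrow> r *\<^sub>R x \<in> S" "x \<in> S \<Longrightarrow> - x \<in> S" "x \<in> S \<Longrightarrow> y \<in> S \<Longrightarrow> x - y \<in> S"
proof -
  show 1: "0 \<in> S" "\<And>x y. x \<in> S \<Longrightarrow> y \<in> S \<Longrightarrow> x + y \<in> S" "\<And>c x. x \<in> S \<Longrightarrow> scaleC c x \<in> S"
    using assms by (auto simp: csubspace_def)
  show "x \<in> S \<Longrightarrow> r *\<^sub>R x \<in> S" using 1(3) by (simp add: scaleR_scaleC)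
  show 2: "\<And>x. x \<in> S \<Longrightarrow> - x \<in> S" using 1(3) by (metis scaleC_minus1)
  show "x \<in> S \<Longrightarrow> y \<in> S \<Longrightarrow> x - y \<in> S" using 1(2)[OF _ 2, of x y] by simp
qed

lemma csubspace_sum:
  assumes "csubspace S" "\<And>i. i \<in> I \<Longrightarrow> f i \<in> S"
  shows "sum f I \<in> S"
  using assms(2) by (induction I rule: infinite_finite_induct) (auto intro: csubspaceD[OF assms(1)])

lemma csubspace_closure:
  fixes S :: "'a::complex_inner set"
  assumes "csubspace S"
  shows "csubspace (closure S)"
  unfolding csubspace_def
proof (intro conjI ballI allI)
  show "0 \<in> closure S" using csubspaceD(1)[OF assms] closure_subset by blast
next
  fix x y assume "x \<in> closure S" "y \<in> closure S"
  then obtain u v where "\<And>n. u n \<in> S" "u \<longlonglongrightarrow> x" "\<And>n. v n \<in> S" "v \<longlonglongrightarrow> y"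
    by (auto simp: closure_sequential)
  then show "x + y \<in> closure S" unfolding closure_sequential
    by (intro exI[of _ "\<lambda>n. u n + v n"]) (auto intro: tendsto_add csubspaceD[OF assms])
next
  fix c and x assume "x \<in> closure S"
  then obtain u where "\<And>n. u n \<in> S" "u \<longlonglongrightarrow> x"
    by (auto simp: closure_sequential)
  then show "scaleC c x \<in> closure S" unfolding closure_sequential
    by (intro exI[of _ "\<lambda>n. scaleC c (u n)"])
       (auto intro: csubspaceD[OF assms] bounded_linear.tendsto[OF bounded_linear_scaleC])
qed

lemma orthogonal_dense_eq_zero:
  fixes z :: "'a::complex_inner"
  assumes "closure S = UNIV" "\<And>x. x \<in> S \<Longrightarrow> cinner x z = 0"
  shows "z = 0"
proof -
  obtain u where u: "\<And>n. u n \<in> S" "u \<longlonglongrightarrow> z"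
    using assms(1) by (metis UNIV_I closure_sequential)
  have "(\<lambda>n. cinner (u n) z) \<longlonglongrightarrow> cinner z z"
    by (intro tendsto_cinner u tendsto_const)
  then show ?thesis using assms(2)[OF u(1)] LIMSEQ_unique[OF tendsto_const] cinner_eq_zero_iff
    by (metis (no_types, lifting) ext)
qed

lemma cinner_eqI_dense:
  fixes y z :: "'a::complex_inner"
  assumes "closure S = UNIV" "\<And>x. x \<in> S \<Longrightarrow> cinner x y = cinner x z"
  shows "y = z"
  using orthogonal_dense_eq_zero[OF assms(1), of "y - z"] assms(2) by (simp add: cinner_diff_right)

text \<open>The product series is compared with the scalar series
  \<open>(\<Sum>n. norm (a n)) * (\<Sum>n. norm (b n))\<close>, whose square and triangular partial sums have the
  same limit.\<close>

lemma (in bounded_bilinear) Cauchy_product_sums: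
  fixes u :: "nat \<Rightarrow> 'a" and v :: "nat \<Rightarrow> 'b"
  assumes u: "summable (\<lambda>k. norm (u k))" "u sums s"
    and v: "summable (\<lambda>k. norm (v k))" "v sums t"
  shows "(\<lambda>k. \<Sum>i\<le>k. prod (u i) (v (k - i))) sums prod s t"
proof -
  obtain K where K: "K \<ge> 0" "\<And>x y. norm (prod x y) \<le> norm x * norm y * K"
    using nonneg_bounded by blast
  let ?Q = "\<lambda>n::nat. {..<n} \<times> {..<n}" and ?D = "\<lambda>n::nat. {(i,j). i + j < n}"
  let ?f = "\<lambda>(i,j). prod (u i) (v j)" and ?g = "\<lambda>(i,j). norm (u i) * norm (v j)"
  have DQ: "?D n \<subseteq> ?Q n" for n by auto
  have finQ: "finite (?Q n)" for n by simp
  have finD: "finite (?D n)" for n using DQ finQ by (rule finite_subset)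
  have tri: "(\<Sum>k<n. \<Sum>i\<le>k. h (i, k - i)) = sum h (?D n)" for h :: "nat \<times> nat \<Rightarrow> 'd::comm_monoid_add" and n
    using sum.triangle_reindex[of "\<lambda>i j. h (i,j)" n] by (simp add: case_prod_unfold)
  have Qg: "(\<lambda>n. sum ?g (?Q n)) \<longlonglongrightarrow> (\<Sum>k. norm (u k)) * (\<Sum>k. norm (v k))"
    unfolding sum.cartesian_product[symmetric] sum_product[symmetric]
    by (intro tendsto_mult summable_LIMSEQ u v)
  have "(\<lambda>k. \<Sum>i\<le>k. norm (u i) * norm (v (k - i))) sums ((\<Sum>k. norm (u k)) * (\<Sum>k. norm (v k)))"
    using u(1) v(1) by (intro Series.Cauchy_product_sums) simp_all
  then have Dg: "(\<lambda>n. sum ?g (?D n)) \<longlonglongrightarrow> (\<Sum>k. norm (u k)) * (\<Sum>k. norm (v k))"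
    unfolding sums_def using tri[of ?g] by simp
  have Qf: "(\<lambda>n. sum ?f (?Q n)) \<longlonglongrightarrow> prod s t"
  proof -
    have "(\<lambda>n. prod (\<Sum>i<n. u i) (\<Sum>i<n. v i)) \<longlonglongrightarrow> prod s t"
      using u(2) v(2) unfolding sums_def by (rule tendsto)
    moreover have "prod (\<Sum>i<n. u i) (\<Sum>i<n. v i) = sum ?f (?Q n)" for n
      by (subst sum_left) (simp only: sum_right sum.cartesian_product)
    ultimately show ?thesis by simp
  qed
  have "(\<lambda>n. sum ?f (?Q n) - sum ?f (?D n)) \<longlonglongrightarrow> 0"
  proof (rule Lim_null_comparison)
    show "(\<lambda>n. (sum ?g (?Q n) - sum ?g (?D n)) * K) \<longlonglongrightarrow> 0"
      using tendsto_mult_left_zero[OF LIM_zero[OF tendsto_diff[OF Qg Dg], simplified], of K]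
      by (simp add: tendsto_mult_left_zero)
    show "\<forall>\<^sub>F n in sequentially. norm (sum ?f (?Q n) - sum ?f (?D n))
        \<le> (sum ?g (?Q n) - sum ?g (?D n)) * K"
    proof (intro always_eventually allI)
      fix n
      have "norm (sum ?f (?Q n) - sum ?f (?D n)) = norm (sum ?f (?Q n - ?D n))"
        using sum_diff[OF finQ DQ, of ?f] by simp
      also have "\<dots> \<le> (\<Sum>p\<in>?Q n - ?D n. ?g p * K)"
        by (rule sum_norm_le) (auto intro: K)
      also have "\<dots> = (sum ?g (?Q n) - sum ?g (?D n)) * K"
        using sum_diff[OF finQ DQ, of ?g] by (simp flip: sum_distrib_right)
      finally show "norm (sum ?f (?Q n) - sum ?f (?D n)) \<le> (sum ?g (?Q n) - sum ?g (?D n)) * K" .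
    qed
  qed
  from tendsto_diff[OF Qf this] show ?thesis
    unfolding sums_def using tri[of ?f] by simp
qed

instance chilbert_space \<subseteq> banach ..

section \<open>Orthogonal projections\<close>

text \<open>A minimizing sequence for the distance to \<open>x\<close> is Cauchy, by the
  parallelogram law and because midpoints stay in \<open>S\<close>. Its limit is a nearest point,
  and a nearest point leaves an orthogonal remainder.\<close>

lemma projection_exists:
  fixes S :: "'a::chilbert_space set"
  assumes S: "csubspace S" "closed S"
  shows "\<exists>p\<in>S. \<forall>s\<in>S. cinner s (x - p) = 0"
proof -
  define d where "d = (INF s\<in>S. (norm (x - s))\<^sup>2)"
  have bdd: "bdd_below ((\<lambda>s. (norm (x - s))\<^sup>2) ` S)"
    by (rule bdd_belowI2[of _ 0]) simp
  have ne: "S \<noteq> {}" using csubspaceD(1)[OF S(1)] by blast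
  have d_le: "d \<le> (norm (x - s))\<^sup>2" if "s \<in> S" for s
    unfolding d_def by (rule cINF_lower[OF bdd that])
  have "\<exists>s\<in>S. (norm (x - s))\<^sup>2 < d + inverse (real (Suc n))" for n
    using cINF_less_iff[OF ne bdd, of "d + inverse (real (Suc n))"] unfolding d_def[symmetric] by simp
  then obtain p where p: "\<And>n. p n \<in> S" "\<And>n. (norm (x - p n))\<^sup>2 < d + inverse (real (Suc n))"
    by metis
  have dist: "(norm (p m - p n))\<^sup>2 \<le> 2 * inverse (real (Suc m)) + 2 * inverse (real (Suc n))" for m n
  proof -
    have "(1/2) *\<^sub>R (p m + p n) \<in> S" using p(1) by (intro csubspaceD[OF S(1)])
    then have "d \<le> (norm (x - (1/2) *\<^sub>R (p m + p n)))\<^sup>2" by (rule d_le)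
    moreover have "(x - p m) + (x - p n) = 2 *\<^sub>R (x - (1/2) *\<^sub>R (p m + p n))"
      by (simp add: algebra_simps scaleR_2)
    ultimately have "4 * d \<le> (norm ((x - p m) + (x - p n)))\<^sup>2"
      by (simp add: power_mult_distrib)
    with parallelogram[of "x - p m" "x - p n"] p(2)[of m] p(2)[of n]
    show ?thesis by (simp add: norm_minus_commute)
  qed
  have "Cauchy p"
  proof (rule CauchyI)
    fix e :: real assume e: "e > 0"
    obtain N where N: "inverse (real (Suc N)) < e\<^sup>2 / 4"
      using reals_Archimedean[of "e\<^sup>2 / 4"] e by auto
    show "\<exists>M. \<forall>m\<ge>M. \<forall>n\<ge>M. norm (p m - p n) < e"
    proof (intro exI[of _ N] allI impI)
      fix m n assume "N \<le> m" "N \<le> n"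
      then have "inverse (real (Suc m)) \<le> inverse (real (Suc N))"
        "inverse (real (Suc n)) \<le> inverse (real (Suc N))" by (simp_all add: le_imp_inverse_le)
      then have "(norm (p m - p n))\<^sup>2 < e\<^sup>2" using dist[of m n] N by linarith
      then show "norm (p m - p n) < e" using e by (simp add: power_less_imp_less_base)
    qed
  qed
  then obtain q where q: "p \<longlonglongrightarrow> q" using Cauchy_convergent convergentD by blast
  have qS: "q \<in> S" using S(2) p(1) q by (meson closed_sequentially)
  have "(norm (x - q))\<^sup>2 \<le> d + 0"
  proof (rule LIMSEQ_le)
    show "(\<lambda>n. (norm (x - p n))\<^sup>2) \<longlonglongrightarrow> (norm (x - q))\<^sup>2" by (intro tendsto_intros q)
    show "(\<lambda>n. d + inverse (real (Suc n))) \<longlonglongrightarrow> d + 0"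
      by (intro tendsto_intros LIMSEQ_inverse_real_of_nat)
    show "\<exists>N. \<forall>n\<ge>N. (norm (x - p n))\<^sup>2 \<le> d + inverse (real (Suc n))"
      using p(2) less_imp_le by blast
  qed
  then have qmin: "(norm (x - q))\<^sup>2 \<le> (norm (x - s))\<^sup>2" if "s \<in> S" for s
    using order_trans[OF _ d_le[OF that]] by simp
  have "cinner s (x - q) = 0" if s: "s \<in> S" for s
  proof (cases "s = 0")
    case False
    \<comment> \<open>Moving \<open>q\<close> by \<open>scaleC c s\<close> would shorten the
      remainder by exactly that component, so minimality forces \<open>c = 0\<close>.\<close>
    define c where "c = cinner s (x - q) / complex_of_real ((norm s)\<^sup>2)"
    have nz: "complex_of_real ((norm s)\<^sup>2) \<noteq> 0" using False by simp
    define r where "r = (x - q) - scaleC c s"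
    have "cinner s r = 0"
      using nz by (simp add: r_def cinner_diff_right[of s "x - q"] cinner_scaleC_right cinner_self c_def)
    then have "cinner (scaleC c s) r = 0" by (simp add: cinner_scaleC_left)
    then have "(norm (x - q))\<^sup>2 = (norm (scaleC c s))\<^sup>2 + (norm r)\<^sup>2"
      using norm_add_squared[of "scaleC c s" r] by (simp add: r_def)
    moreover have "(norm (x - q))\<^sup>2 \<le> (norm r)\<^sup>2"
      using qmin[of "q + scaleC c s"] s qS
      by (simp add: r_def csubspaceD[OF S(1)] diff_diff_eq)
    ultimately have "norm (scaleC c s) = 0" by simp
    then have "c = 0" using False by (simp add: norm_scaleC)
    then show ?thesis using nz by (simp add: c_def)
  qed simp
  with qS show ?thesis by blast
qed

lemma orthogonal_complement_zero_imp_dense: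
  fixes S :: "'a::chilbert_space set"
  assumes "csubspace S" "\<And>z. (\<And>s. s \<in> S \<Longrightarrow> cinner s z = 0) \<Longrightarrow> z = 0"
  shows "closure S = UNIV"
proof -
  have "x \<in> closure S" for x
  proof -
    obtain p where p: "p \<in> closure S" "\<And>s. s \<in> closure S \<Longrightarrow> cinner s (x - p) = 0"
      using projection_exists[OF csubspace_closure[OF assms(1)] closed_closure] by blast
    have "x - p = 0" by (rule assms(2)) (use p closure_subset in blast)
    with p(1) show ?thesis by simp
  qed
  then show ?thesis by blast
qed

text \<open>Graphs of closed operators become closed subspaces of a Hilbert space, so that they
  admit orthogonal projections. The norm already fixed on pairs is the Euclidean one and matches
  this inner product.\<close>

instantiation prod :: (complex_inner, complex_inner) complex_inner
begin

definition scaleC_prod_def: "scaleC c z = (scaleC c (fst z), scaleC c (snd z))"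
definition cinner_prod_def: "cinner z w = cinner (fst z) (fst w) + cinner (snd z) (snd w)"

instance
proof
  fix x y z :: "'a \<times> 'b" and a b :: complex and r :: real
  show "scaleC a (x + y) = scaleC a x + scaleC a y"
    by (simp add: scaleC_prod_def scaleC_add_right)
  show "scaleC (a + b) x = scaleC a x + scaleC b x"
    by (simp add: scaleC_prod_def scaleC_add_left)
  show "scaleC a (scaleC b x) = scaleC (a * b) x"
    by (simp add: scaleC_prod_def scaleC_scaleC)
  show "scaleC 1 x = x"
    by (simp add: scaleC_prod_def scaleC_one)
  show "scaleR r x = scaleC (complex_of_real r) x"
    by (simp add: scaleC_prod_def scaleR_prod_def scaleR_scaleC)
  show "cinner x y = cnj (cinner y x)"
    by (simp add: cinner_prod_def flip: cinner_cnj)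
  show "cinner x (y + z) = cinner x y + cinner x z"
    by (simp add: cinner_prod_def cinner_add_right)
  show "cinner x (scaleC a y) = a * cinner x y"
    by (simp add: cinner_prod_def scaleC_prod_def cinner_scaleC_right algebra_simps)
  show "Im (cinner x x) = 0"
    by (simp add: cinner_prod_def cinner_self_real)
  show "0 \<le> Re (cinner x x)"
    by (simp add: cinner_prod_def cinner_self_nonneg)
  show "cinner x x = 0 \<longleftrightarrow> x = 0"
    by (simp only: cinner_prod_def cinner_self prod_eq_iff of_real_add[symmetric] of_real_eq_0_iff
        sum_power2_eq_zero_iff norm_eq_zero fst_zero snd_zero)
  show "norm x = sqrt (Re (cinner x x))"
    by (simp add: cinner_prod_def Re_cinner_self norm_prod_def)
qed

end

instance prod :: (chilbert_space, chilbert_space) chilbert_space ..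

lemma cinner_Pair [simp]: "cinner (a, b) (c, d) = cinner a c + cinner b d"
  by (simp add: cinner_prod_def)

lemma scaleC_Pair [simp]: "scaleC c (a, b) = (scaleC c a, scaleC c b)"
  by (simp add: scaleC_prod_def)

section \<open>Closed operators, adjoints and normal operators\<close>

lemma linear_opD:
  assumes "linear_op T"
  shows "csubspace (opdom T)"
    "x \<in> opdom T \<Longrightarrow> y \<in> opdom T \<Longrightarrow> opapp T (x + y) = opapp T x + opapp T y"
    "x \<in> opdom T \<Longrightarrow> opapp T (scaleC c x) = scaleC c (opapp T x)"
  using assms by (auto simp: linear_op_def)

lemma linear_op_zero:
  assumes "linear_op T"
  shows "opapp T 0 = 0"
  using linear_opD(2)[OF assms, of 0 0] csubspaceD(1)[OF linear_opD(1)[OF assms]] by simp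

lemma linear_op_diff:
  assumes "linear_op T" "x \<in> opdom T" "y \<in> opdom T"
  shows "opapp T (x - y) = opapp T x - opapp T y"
  using linear_opD(2)[OF assms(1,2), of "scaleC (-1) y"] linear_opD(3)[OF assms(1,3), of "-1"]
    csubspaceD(3)[OF linear_opD(1)[OF assms(1)] assms(3), of "-1"]
  by (simp add: scaleC_minus1)

lemma closed_opD:
  assumes "closed_op T" "\<And>n. X n \<in> opdom T" "X \<longlonglongrightarrow> x" "(\<lambda>n. opapp T (X n)) \<longlonglongrightarrow> y"
  shows "x \<in> opdom T" "opapp T x = y"
proof -
  have "(x, y) \<in> graph T"
  proof (rule closed_sequentially)
    show "closed (graph T)" using assms(1) by (simp add: closed_op_def)
    show "(X n, opapp T (X n)) \<in> graph T" for n using assms(2) by (auto simp: graph_def)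
    show "(\<lambda>n. (X n, opapp T (X n))) \<longlonglongrightarrow> (x, y)" by (intro tendsto_Pair assms)
  qed
  then show "x \<in> opdom T" "opapp T x = y" by (auto simp: graph_def)
qed

lemma op_adjointI:
  assumes "densely_defined T" "\<And>x. x \<in> opdom T \<Longrightarrow> cinner (opapp T x) y = cinner x z"
  shows "y \<in> opdom (op_adjoint T)" "opapp (op_adjoint T) y = z"
proof -
  show "y \<in> opdom (op_adjoint T)"
    using assms(2) by (auto simp: op_adjoint_def opdom_def)
  have "(THE z. \<forall>x\<in>opdom T. cinner (opapp T x) y = cinner x z) = z"
  proof (rule the_equality)
    fix w assume "\<forall>x\<in>opdom T. cinner (opapp T x) y = cinner x w"
    then show "w = z"
      using assms by (intro cinner_eqI_dense[of "opdom T"]) (auto simp: densely_defined_def)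
  qed (use assms in blast)
  then show "opapp (op_adjoint T) y = z"
    by (simp add: op_adjoint_def opapp_def)
qed

lemma op_adjointD:
  assumes "densely_defined T" "y \<in> opdom (op_adjoint T)" "x \<in> opdom T"
  shows "cinner (opapp T x) y = cinner x (opapp (op_adjoint T) y)"
proof -
  obtain z where z: "\<And>x. x \<in> opdom T \<Longrightarrow> cinner (opapp T x) y = cinner x z"
    using assms(2) by (auto simp: op_adjoint_def opdom_def)
  with op_adjointI(2)[OF assms(1) z] assms(3) show ?thesis by simp
qed

lemma op_adjointD':
  assumes "densely_defined T" "y \<in> opdom (op_adjoint T)" "x \<in> opdom T"
  shows "cinner (opapp (op_adjoint T) y) x = cinner y (opapp T x)"
  using op_adjointD[OF assms] by (metis cinner_cnj)

lemma closed_op_adjoint: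
  assumes T: "densely_defined T"
  shows "closed_op (op_adjoint T)"
proof -
  let ?T = "op_adjoint T"
  have add: "x + y \<in> opdom ?T \<and> opapp ?T (x + y) = opapp ?T x + opapp ?T y"
    if "x \<in> opdom ?T" "y \<in> opdom ?T" for x y
    using op_adjointI[OF T, of "x + y" "opapp ?T x + opapp ?T y"] that
    by (simp add: cinner_add_right op_adjointD[OF T])
  have scale: "scaleC c x \<in> opdom ?T \<and> opapp ?T (scaleC c x) = scaleC c (opapp ?T x)"
    if "x \<in> opdom ?T" for c x
    using op_adjointI[OF T, of "scaleC c x" "scaleC c (opapp ?T x)"] that
    by (simp add: cinner_scaleC_right op_adjointD[OF T])
  have "0 \<in> opdom ?T" using op_adjointI[OF T, of 0 0] by simp
  with add scale have "linear_op ?T" by (simp add: linear_op_def csubspace_def)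
  moreover have "closed (graph ?T)"
    unfolding closed_sequential_limits
  proof (intro allI impI, elim conjE)
    fix X p assume X: "\<forall>n. X n \<in> graph ?T" "X \<longlonglongrightarrow> p"
    define u where "u = (\<lambda>n. fst (X n))"
    have u: "u n \<in> opdom ?T" "snd (X n) = opapp ?T (u n)" for n
      using spec[OF X(1), of n] by (auto simp: graph_def u_def)
    have lim: "u \<longlonglongrightarrow> fst p" "(\<lambda>n. opapp ?T (u n)) \<longlonglongrightarrow> snd p"
      using tendsto_fst[OF X(2)] tendsto_snd[OF X(2)] u(2) by (simp_all add: u_def)
    have "cinner (opapp T x) (fst p) = cinner x (snd p)" if x: "x \<in> opdom T" for x
    proof (rule LIMSEQ_unique)
      show "(\<lambda>n. cinner (opapp T x) (u n)) \<longlonglongrightarrow> cinner (opapp T x) (fst p)"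
        by (intro tendsto_cinner tendsto_const lim)
      show "(\<lambda>n. cinner (opapp T x) (u n)) \<longlonglongrightarrow> cinner x (snd p)"
        unfolding op_adjointD[OF T u(1) x] by (intro tendsto_cinner tendsto_const lim)
    qed
    from op_adjointI[OF T this] show "p \<in> graph ?T"
      by (auto simp: graph_def prod_eq_iff)
  qed
  ultimately show ?thesis by (simp add: closed_op_def)
qed

text \<open>The factor \<open>c\<close> serves the graph of \<open>sqrt e\<close> times
  \<open>T\<close> below, and is 1 in the other uses; the restriction to \<open>S\<close> serves the
  cores.\<close>

lemma csubspace_graph_restrict:
  assumes T: "linear_op T" and S: "csubspace S" "S \<subseteq> opdom T"
  shows "csubspace ((\<lambda>x. (x, scaleC c (opapp T x))) ` S)"
  unfolding csubspace_def
proof (intro conjI ballI allI)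
  have "scaleC c (0::'a) = 0"
    using bounded_linear.linear[OF bounded_linear_scaleC] by (rule linear_0)
  then show "0 \<in> (\<lambda>x. (x, scaleC c (opapp T x))) ` S"
    using csubspaceD(1)[OF S(1)] linear_op_zero[OF T]
    by (intro image_eqI[of _ _ 0]) (simp_all add: prod_eq_iff)
next
  fix p q assume "p \<in> (\<lambda>x. (x, scaleC c (opapp T x))) ` S" "q \<in> (\<lambda>x. (x, scaleC c (opapp T x))) ` S"
  then obtain x y where "x \<in> S" "y \<in> S" "p = (x, scaleC c (opapp T x))" "q = (y, scaleC c (opapp T y))"
    by blast
  then show "p + q \<in> (\<lambda>x. (x, scaleC c (opapp T x))) ` S"
    using S(2) by (intro image_eqI[of _ _ "x + y"])
      (auto simp: linear_opD(2)[OF T] subset_iff scaleC_add_right csubspaceD[OF S(1)])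
next
  fix d p assume "p \<in> (\<lambda>x. (x, scaleC c (opapp T x))) ` S"
  then obtain x where "x \<in> S" "p = (x, scaleC c (opapp T x))"
    by blast
  then show "scaleC d p \<in> (\<lambda>x. (x, scaleC c (opapp T x))) ` S"
    using S(2) by (intro image_eqI[of _ _ "scaleC d x"])
      (auto simp: linear_opD(3)[OF T] subset_iff scaleC_scaleC mult.commute csubspaceD[OF S(1)])
qed

text \<open>The point \<open>x\<close> comes from projecting \<open>(z, 0)\<close> onto the graph of \<open>\<surd>e T\<close>.\<close>

lemma one_plus_adjoint_comp_surj:
  fixes T :: "'a::chilbert_space lop"
  assumes T: "densely_defined T" "closed_op T" and e: "e > 0"
  shows "\<exists>x\<in>opdom T. opapp T x \<in> opdom (op_adjoint T)
    \<and> x + e *\<^sub>R opapp (op_adjoint T) (opapp T x) = z"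
proof -
  have lin: "linear_op T" using T(2) by (simp add: closed_op_def)
  define c where "c = complex_of_real (sqrt e)"
  have cc: "c * c = complex_of_real e" "cnj c = c" "c \<noteq> 0"
    using e by (simp_all add: c_def flip: of_real_mult)
  define G where "G = (\<lambda>x. (x, scaleC c (opapp T x))) ` opdom T"
  have "csubspace G"
    unfolding G_def by (rule csubspace_graph_restrict[OF lin linear_opD(1)[OF lin] order_refl])
  moreover have "closed G"
    unfolding closed_sequential_limits
  proof (intro allI impI, elim conjE)
    fix X p assume X: "\<forall>n. X n \<in> G" "X \<longlonglongrightarrow> p"
    define u where "u = (\<lambda>n. fst (X n))"
    have u: "u n \<in> opdom T" "snd (X n) = scaleC c (opapp T (u n))" for n
      using spec[OF X(1), of n] by (auto simp: G_def u_def)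
    have inv: "scaleC (inverse c) (scaleC c y) = y" for y :: 'a
      using cc by (simp add: scaleC_scaleC scaleC_one)
    have "(\<lambda>n. scaleC (inverse c) (snd (X n))) \<longlonglongrightarrow> scaleC (inverse c) (snd p)"
      by (intro bounded_linear.tendsto[OF bounded_linear_scaleC] tendsto_snd X)
    then have "(\<lambda>n. opapp T (u n)) \<longlonglongrightarrow> scaleC (inverse c) (snd p)"
      by (simp add: u(2) inv)
    moreover have "u \<longlonglongrightarrow> fst p"
      using tendsto_fst[OF X(2)] by (simp add: u_def)
    ultimately have "fst p \<in> opdom T" "opapp T (fst p) = scaleC (inverse c) (snd p)"
      using closed_opD[OF T(2), of u, OF u(1)] by simp_all
    then show "p \<in> G"
      unfolding G_def using cc
      by (intro image_eqI[of _ _ "fst p"]) (auto simp: prod_eq_iff scaleC_scaleC scaleC_one)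
  qed
  ultimately obtain p where p: "p \<in> G" "\<And>s. s \<in> G \<Longrightarrow> cinner s ((z, 0) - p) = 0"
    using projection_exists[of G "(z, 0)"] by blast
  from p(1) obtain x where x: "x \<in> opdom T" "p = (x, scaleC c (opapp T x))"
    by (auto simp: G_def)
  \<comment> \<open>Orthogonality of \<open>(z - x, - scaleC c (opapp T x))\<close> to the graph
    says that \<open>w\<close> represents the adjoint at \<open>opapp T x\<close>.\<close>
  define w where "w = (1 / e) *\<^sub>R (z - x)"
  have "cinner (opapp T y) (opapp T x) = cinner y w" if y: "y \<in> opdom T" for y
  proof -
    have "cinner y (z - x) = (c * c) * cinner (opapp T y) (opapp T x)"
      using p(2)[of "(y, scaleC c (opapp T y))"] y cc
      by (simp add: x(2) G_def cinner_scaleC_left cinner_scaleC_right cinner_minus_right)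
    then show ?thesis
      using e unfolding w_def cinner_scaleR_right cc by (simp add: scaleR_conv_of_real)
  qed
  from op_adjointI[OF T(1) this] x(1) e show ?thesis
    by (intro bexI[of _ x]) (auto simp: w_def)
qed

text \<open>This is \<open>T** = T\<close>. Projecting \<open>(y, z)\<close> onto the graph leaves a
  remainder \<open>(a, b)\<close> whose orthogonality means that the adjoint sends \<open>b\<close>
  to \<open>- a\<close>. Testing the hypothesis at \<open>u = b\<close> then gives
  \<open>cinner b b = - cinner a a\<close>, so both vanish.\<close>

lemma biadjointI:
  fixes T :: "'a::chilbert_space lop"
  assumes T: "densely_defined T" "closed_op T"
    and yz: "\<And>u. u \<in> opdom (op_adjoint T) \<Longrightarrow> cinner u z = cinner (opapp (op_adjoint T) u) y"
  shows "y \<in> opdom T" "opapp T y = z"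
proof -
  have lin: "linear_op T" using T(2) by (simp add: closed_op_def)
  have G: "csubspace (graph T)"
    using csubspace_graph_restrict[OF lin linear_opD(1)[OF lin] order_refl, of 1]
    by (simp add: scaleC_one graph_def image_def Collect_conj_eq) (simp add: Bex_def conj_commute)
  obtain p where p: "p \<in> graph T" "\<And>s. s \<in> graph T \<Longrightarrow> cinner s ((y, z) - p) = 0"
    using projection_exists[OF G, of "(y, z)"] T(2) by (auto simp: closed_op_def)
  from p(1) obtain x where x: "x \<in> opdom T" "p = (x, opapp T x)"
    by (auto simp: graph_def)
  define a b where "a = y - x" and "b = z - opapp T x"
  have "cinner (opapp T w) b = cinner w (x - y)" if w: "w \<in> opdom T" for w
    using p(2)[of "(w, opapp T w)"] w
    by (auto simp: x(2) graph_def b_def cinner_diff_right add_eq_0_iff)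
  from op_adjointI[OF T(1) this] have b: "b \<in> opdom (op_adjoint T)" "opapp (op_adjoint T) b = - a"
    by (auto simp: a_def)
  have "cinner b b = cinner b z - cinner b (opapp T x)"
    by (simp add: b_def cinner_diff_right)
  also have "\<dots> = cinner (- a) y - cinner (- a) x"
    using yz[OF b(1)] op_adjointD'[OF T(1) b(1) x(1)] b(2) by simp
  also have "\<dots> = - cinner a a"
    by (simp add: a_def cinner_minus_left cinner_diff_left cinner_diff_right)
  finally have "complex_of_real ((norm b)\<^sup>2 + (norm a)\<^sup>2) = 0"
    by (simp add: cinner_self)
  then have "(norm b)\<^sup>2 + (norm a)\<^sup>2 = 0" by (simp only: of_real_eq_0_iff)
  then have "a = 0" "b = 0" by (auto simp: sum_power2_eq_zero_iff)
  then show "y \<in> opdom T" "opapp T y = z" using x(1) by (auto simp: a_def b_def)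
qed

text \<open>The assumption \<open>orth\<close> says that no nonzero point of the graph of
  \<open>T\<close> is orthogonal to the graph over \<open>S\<close>. The remainder after projecting
  a graph point onto the closure of the latter is such a point.\<close>

lemma operator_core:
  fixes T :: "'a::chilbert_space lop"
  assumes T: "closed_op T" and S: "csubspace S" "S \<subseteq> opdom T"
    and orth: "\<And>x. x \<in> opdom T \<Longrightarrow> (\<And>s. s \<in> S \<Longrightarrow> cinner s x + cinner (opapp T s) (opapp T x) = 0) \<Longrightarrow> x = 0"
    and x: "x \<in> opdom T"
  obtains X where "\<And>n. X n \<in> S" "X \<longlonglongrightarrow> x" "(\<lambda>n. opapp T (X n)) \<longlonglongrightarrow> opapp T x"
proof -
  have lin: "linear_op T" using T by (simp add: closed_op_def)
  define G where "G = (\<lambda>x. (x, opapp T x)) ` S"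
  have G: "csubspace G"
    using csubspace_graph_restrict[OF lin S, of 1] by (simp add: scaleC_one G_def)
  obtain p where p: "p \<in> closure G" "\<And>s. s \<in> closure G \<Longrightarrow> cinner s ((x, opapp T x) - p) = 0"
    using projection_exists[OF csubspace_closure[OF G] closed_closure] by blast
  have "closure G \<subseteq> graph T"
    using T S(2) by (intro closure_minimal) (auto simp: G_def graph_def closed_op_def)
  with p(1) obtain w where w: "w \<in> opdom T" "p = (w, opapp T w)"
    by (auto simp: graph_def)
  note diff = linear_op_diff[OF lin x w(1)]
  have "x - w = 0"
  proof (rule orth)
    show "x - w \<in> opdom T" using x w by (intro csubspaceD[OF linear_opD(1)[OF lin]])
    show "cinner s (x - w) + cinner (opapp T s) (opapp T (x - w)) = 0" if "s \<in> S" for s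
      using p(2)[of "(s, opapp T s)"] that closure_subset[of G] by (auto simp: G_def w(2) diff)
  qed
  then have "(x, opapp T x) \<in> closure G" using p(1) w by simp
  then obtain Y where Y: "\<And>n. Y n \<in> G" "Y \<longlonglongrightarrow> (x, opapp T x)"
    unfolding closure_sequential by blast
  show ?thesis
  proof
    show "fst (Y n) \<in> S" for n using Y(1)[of n] by (auto simp: G_def)
    show "(\<lambda>n. fst (Y n)) \<longlonglongrightarrow> x" using tendsto_fst[OF Y(2)] by simp
    have "opapp T (fst (Y n)) = snd (Y n)" for n using Y(1)[of n] by (auto simp: G_def)
    then show "(\<lambda>n. opapp T (fst (Y n))) \<longlonglongrightarrow> opapp T x" using tendsto_snd[OF Y(2)] by simp
  qed
qed

text \<open>Applied to differences, equality of norms turns convergence of the images under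
  \<open>T1\<close> into the Cauchy property under \<open>T2\<close>; closedness of
  \<open>T2\<close> does the rest.\<close>

lemma norm_eq_on_core:
  fixes T1 T2 :: "'a::chilbert_space lop"
  assumes T: "closed_op T1" "closed_op T2" and S: "csubspace S" "S \<subseteq> opdom T1" "S \<subseteq> opdom T2"
    and eq: "\<And>s. s \<in> S \<Longrightarrow> norm (opapp T1 s) = norm (opapp T2 s)"
    and X: "\<And>n. X n \<in> S" "X \<longlonglongrightarrow> x" "(\<lambda>n. opapp T1 (X n)) \<longlonglongrightarrow> opapp T1 x"
  shows "x \<in> opdom T2" "norm (opapp T2 x) = norm (opapp T1 x)"
proof -
  have diff: "opapp U (X m) - opapp U (X n) = opapp U (X m - X n)"
    if "closed_op U" "S \<subseteq> opdom U" for U m n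
    using linear_op_diff[of U "X m" "X n"] that X(1) by (simp add: closed_op_def subset_iff)
  have "Cauchy (\<lambda>n. opapp T1 (X n))" using X(3) by (rule LIMSEQ_imp_Cauchy)
  moreover have "norm (opapp T1 (X m) - opapp T1 (X n)) = norm (opapp T2 (X m) - opapp T2 (X n))" for m n
    unfolding diff[OF T(1) S(2)] diff[OF T(2) S(3)]
    by (intro eq csubspaceD[OF S(1)] X)
  ultimately have "Cauchy (\<lambda>n. opapp T2 (X n))"
    by (simp add: Cauchy_iff)
  then obtain y where y: "(\<lambda>n. opapp T2 (X n)) \<longlonglongrightarrow> y"
    using Cauchy_convergent convergentD by blast
  have "\<And>n. X n \<in> opdom T2" using X(1) S(3) by blast
  note * = closed_opD[OF T(2) this X(2) y]
  show "x \<in> opdom T2" by (rule *)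
  have "(\<lambda>n. norm (opapp T1 (X n))) \<longlonglongrightarrow> norm y"
    using tendsto_norm[OF y] eq[OF X(1)] by simp
  then show "norm (opapp T2 x) = norm (opapp T1 x)"
    using tendsto_norm[OF X(3)] LIMSEQ_unique * by metis
qed

lemma normal_op_comm:
  assumes "normal_op N"
  shows "x \<in> opdom (op_adjoint N) \<and> opapp (op_adjoint N) x \<in> opdom N
      \<longleftrightarrow> x \<in> opdom N \<and> opapp N x \<in> opdom (op_adjoint N)"
    and "x \<in> opdom N \<Longrightarrow> opapp N x \<in> opdom (op_adjoint N)
      \<Longrightarrow> opapp N (opapp (op_adjoint N) x) = opapp (op_adjoint N) (opapp N x)"
  using assms unfolding normal_op_def op_le_def op_comp_def
  by (auto simp: opdom_def opapp_def)

lemma normal_op_norm_eq_comp: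
  assumes "normal_op N" "x \<in> opdom N" "opapp N x \<in> opdom (op_adjoint N)"
  shows "norm (opapp N x) = norm (opapp (op_adjoint N) x)"
proof -
  have N: "densely_defined N" using assms(1) by (simp add: normal_op_def)
  have x: "x \<in> opdom (op_adjoint N)" "opapp (op_adjoint N) x \<in> opdom N"
    using normal_op_comm(1)[OF assms(1)] assms by blast+
  have "cinner (opapp (op_adjoint N) x) (opapp (op_adjoint N) x)
      = cinner (opapp (op_adjoint N) (opapp N x)) x"
    using op_adjointD[OF N x] normal_op_comm(2)[OF assms] by simp
  also have "\<dots> = cinner (opapp N x) (opapp N x)"
    by (rule op_adjointD'[OF N assms(3,2)])
  finally have "(norm (opapp (op_adjoint N) x))\<^sup>2 = (norm (opapp N x))\<^sup>2"
    by (metis Re_cinner_self)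
  then show ?thesis by simp
qed

text \<open>The common domain \<open>S\<close> of both products is a core for \<open>N\<close> and
  for its adjoint, because \<open>1 + N* N\<close> maps it onto the whole space. On \<open>S\<close>
  the two norms agree, and this passes to graph limits in both directions.\<close>

lemma normal_op_adjoint_dom:
  fixes N :: "'a::chilbert_space lop"
  assumes "normal_op N"
  shows "opdom (op_adjoint N) = opdom N"
    and "x \<in> opdom N \<Longrightarrow> norm (opapp (op_adjoint N) x) = norm (opapp N x)"
proof -
  have N: "densely_defined N" "closed_op N" using assms by (simp_all add: normal_op_def)
  note N' = closed_op_adjoint[OF N(1)]
  have lin: "linear_op N" "linear_op (op_adjoint N)" using N(2) N' by (simp_all add: closed_op_def)
  define S where "S = {x \<in> opdom N. opapp N x \<in> opdom (op_adjoint N)}"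
  have S: "csubspace S" "S \<subseteq> opdom N" "S \<subseteq> opdom (op_adjoint N)"
  proof -
    show "csubspace S"
      unfolding csubspace_def S_def
      by (auto simp: linear_op_zero[OF lin(1)] linear_opD(2,3)[OF lin(1)] intro: csubspaceD[OF linear_opD(1)[OF lin(1)]]
          csubspaceD[OF linear_opD(1)[OF lin(2)]])
    show "S \<subseteq> opdom N" "S \<subseteq> opdom (op_adjoint N)"
      using normal_op_comm(1)[OF assms] unfolding S_def by blast+
  qed
  have eq: "norm (opapp N s) = norm (opapp (op_adjoint N) s)" if "s \<in> S" for s
    using normal_op_norm_eq_comp[OF assms] that by (simp add: S_def)
  have surj: "\<exists>s\<in>S. s + opapp (op_adjoint N) (opapp N s) = x" for x
    using one_plus_adjoint_comp_surj[OF N, of 1 x] by (auto simp: S_def)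
  have core: "\<exists>X. (\<forall>n. X n \<in> S) \<and> X \<longlonglongrightarrow> x \<and> (\<lambda>n. opapp N (X n)) \<longlonglongrightarrow> opapp N x"
    if "x \<in> opdom N" for x
  proof (rule operator_core[OF N(2) S(1,2) _ that])
    fix x assume x: "x \<in> opdom N"
      and orth: "\<And>s. s \<in> S \<Longrightarrow> cinner s x + cinner (opapp N s) (opapp N x) = 0"
    \<comment> \<open>For this \<open>s\<close>, the sum in \<open>orth\<close> is exactly
      \<open>cinner x x\<close>.\<close>
    obtain s where s: "s \<in> S" "s + opapp (op_adjoint N) (opapp N s) = x" using surj by blast
    have "cinner (opapp (op_adjoint N) (opapp N s)) x = cinner (opapp N s) (opapp N x)"
      using op_adjointD'[OF N(1) _ x] s(1) by (simp add: S_def)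
    then have "cinner x x = 0" using orth[OF s(1)] s(2) by (metis cinner_add_left)
    then show "x = 0" by (simp add: cinner_eq_zero_iff)
  qed blast
  have core': "\<exists>X. (\<forall>n. X n \<in> S) \<and> X \<longlonglongrightarrow> x
      \<and> (\<lambda>n. opapp (op_adjoint N) (X n)) \<longlonglongrightarrow> opapp (op_adjoint N) x"
    if "x \<in> opdom (op_adjoint N)" for x
  proof (rule operator_core[OF N' S(1,3) _ that])
    fix x assume x: "x \<in> opdom (op_adjoint N)"
      and orth: "\<And>s. s \<in> S \<Longrightarrow>
        cinner s x + cinner (opapp (op_adjoint N) s) (opapp (op_adjoint N) x) = 0"
    obtain s where s: "s \<in> S" "s + opapp (op_adjoint N) (opapp N s) = x" using surj by blast
    have "cinner (opapp N (opapp (op_adjoint N) s)) x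
        = cinner (opapp (op_adjoint N) s) (opapp (op_adjoint N) x)"
      using op_adjointD[OF N(1) x] s(1) normal_op_comm(1)[OF assms] unfolding S_def by blast
    moreover have "opapp N (opapp (op_adjoint N) s) = opapp (op_adjoint N) (opapp N s)"
      using normal_op_comm(2)[OF assms] s(1) by (simp add: S_def)
    ultimately have "cinner x x = 0" using orth[OF s(1)] s(2) by (metis cinner_add_left)
    then show "x = 0" by (simp add: cinner_eq_zero_iff)
  qed blast
  have 1: "x \<in> opdom (op_adjoint N) \<and> norm (opapp (op_adjoint N) x) = norm (opapp N x)"
    if x: "x \<in> opdom N" for x
  proof -
    obtain X where "\<And>n. X n \<in> S" "X \<longlonglongrightarrow> x" "(\<lambda>n. opapp N (X n)) \<longlonglongrightarrow> opapp N x"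
      using core[OF x] by blast
    from norm_eq_on_core[OF N(2) N' S eq this] show ?thesis by blast
  qed
  have 2: "x \<in> opdom N" if x: "x \<in> opdom (op_adjoint N)" for x
  proof -
    obtain X where "\<And>n. X n \<in> S" "X \<longlonglongrightarrow> x"
        "(\<lambda>n. opapp (op_adjoint N) (X n)) \<longlonglongrightarrow> opapp (op_adjoint N) x"
      using core'[OF x] by blast
    from norm_eq_on_core(1)[OF N' N(2) S(1,3,2) eq[symmetric] this] show ?thesis .
  qed
  show "opdom (op_adjoint N) = opdom N" using 1 2 by blast
  show "x \<in> opdom N \<Longrightarrow> norm (opapp (op_adjoint N) x) = norm (opapp N x)" using 1 by blast
qed

text \<open>Pairs in the closure of \<open>{(N\<^sup>* u, N u)}\<close> have components of equal norm, so this closed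
  subspace is the graph of a partial isometry. If \<open>(p, q)\<close> is the projection of \<open>(0, x)\<close> onto it,
  polarization turns the orthogonality relation into \<open>\<langle>x, N u\<rangle> = \<langle>2 p, N\<^sup>* u\<rangle>\<close>, hence
  \<open>N (2 p) = N\<^sup>* x\<close>.\<close>

lemma normal_op_range_adjoint_subset:
  fixes N :: "'a::chilbert_space lop"
  assumes "normal_op N" and x: "x \<in> opdom N"
  shows "\<exists>y\<in>opdom N. opapp N y = opapp (op_adjoint N) x"
proof -
  have N: "densely_defined N" "closed_op N" using assms by (simp_all add: normal_op_def)
  note N' = closed_op_adjoint[OF N(1)]
  have lin: "linear_op N" "linear_op (op_adjoint N)" using N(2) N' by (simp_all add: closed_op_def)
  note dom = normal_op_adjoint_dom[OF assms(1)]
  define G where "G = (\<lambda>u. (opapp (op_adjoint N) u, opapp N u)) ` opdom N"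
  have G: "csubspace G"
    unfolding csubspace_def
  proof (intro conjI ballI allI)
    show "0 \<in> G" unfolding G_def
      using csubspaceD(1)[OF linear_opD(1)[OF lin(1)]] linear_op_zero[OF lin(1)] linear_op_zero[OF lin(2)]
      by (intro image_eqI[of _ _ 0]) (simp_all add: prod_eq_iff)
  next
    fix a b assume "a \<in> G" "b \<in> G"
    then obtain u v where "u \<in> opdom N" "a = (opapp (op_adjoint N) u, opapp N u)"
      "v \<in> opdom N" "b = (opapp (op_adjoint N) v, opapp N v)" by (auto simp: G_def)
    then show "a + b \<in> G" unfolding G_def using dom(1)
      by (intro image_eqI[of _ _ "u + v"])
         (auto simp: linear_opD(2)[OF lin(1)] linear_opD(2)[OF lin(2)] csubspaceD[OF linear_opD(1)[OF lin(1)]])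
  next
    fix c a assume "a \<in> G"
    then obtain u where "u \<in> opdom N" "a = (opapp (op_adjoint N) u, opapp N u)" by (auto simp: G_def)
    then show "scaleC c a \<in> G" unfolding G_def using dom(1)
      by (intro image_eqI[of _ _ "scaleC c u"])
         (auto simp: linear_opD(3)[OF lin(1)] linear_opD(3)[OF lin(2)] csubspaceD[OF linear_opD(1)[OF lin(1)]])
  qed
  note V = csubspace_closure[OF G]
  have iso: "norm (fst p) = norm (snd p)" if p: "p \<in> closure G" for p
  proof -
    obtain X where X: "\<And>n. X n \<in> G" "X \<longlonglongrightarrow> p" using p unfolding closure_sequential by blast
    have "norm (fst (X n)) = norm (snd (X n))" for n
      using X(1)[of n] dom(2) by (auto simp: G_def)
    then show ?thesis
      using tendsto_norm[OF tendsto_fst[OF X(2)]] tendsto_norm[OF tendsto_snd[OF X(2)]]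
        LIMSEQ_unique by simp
  qed
  have polar: "cinner (snd a) (snd b) = cinner (fst a) (fst b)"
    if "a \<in> closure G" "b \<in> closure G" for a b
  proof -
    \<comment> \<open>Equal norms of sums give equal real parts; replacing \<open>b\<close> by
      \<open>scaleC \<i> b\<close> gives the imaginary parts.\<close>
    have re: "Re (cinner (snd a) (snd b)) = Re (cinner (fst a) (fst b))"
      if "a \<in> closure G" "b \<in> closure G" for a b
      using iso[OF csubspaceD(2)[OF V that]] iso[OF that(1)] iso[OF that(2)]
        norm_add_squared[of "fst a" "fst b"] norm_add_squared[of "snd a" "snd b"] by simp
    have "Re (cinner (snd a) (snd (scaleC \<i> b))) = Re (cinner (fst a) (fst (scaleC \<i> b)))"
      using that csubspaceD(3)[OF V] by (intro re)
    then show ?thesis using re[OF that]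
      by (simp add: complex_eq_iff scaleC_prod_def cinner_scaleC_right)
  qed
  obtain p where p: "p \<in> closure G" "\<And>s. s \<in> closure G \<Longrightarrow> cinner s ((0, x) - p) = 0"
    using projection_exists[OF V closed_closure] by blast
  define y where "y = 2 *\<^sub>R fst p"
  have "cinner u (opapp (op_adjoint N) x) = cinner (opapp (op_adjoint N) u) y"
    if u: "u \<in> opdom (op_adjoint N)" for u
  proof -
    let ?s = "(opapp (op_adjoint N) u, opapp N u)"
    have s: "?s \<in> closure G" using u dom closure_subset[of G] by (auto simp: G_def)
    have "cinner (opapp N u) x = cinner (opapp (op_adjoint N) u) (fst p) + cinner (opapp N u) (snd p)"
      using p(2)[OF s] by (cases p) (simp add: cinner_diff_right cinner_minus_right algebra_simps)
    also have "\<dots> = cinner (opapp (op_adjoint N) u) y"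
      using polar[OF s p(1)] by (simp add: y_def cinner_scaleR_right scaleR_conv_of_real)
    finally show ?thesis using op_adjointD[OF N(1), of x u] x u dom by simp
  qed
  from biadjointI[OF N this] show ?thesis by blast
qed

section \<open>Smoothing operators of a normal operator\<close>

lemma tendsto_contractions_dense:
  fixes F :: "nat \<Rightarrow> 'a::metric_space \<Rightarrow> 'a"
  assumes S: "closure S = UNIV" and contr: "\<And>n x y. dist (F n x) (F n y) \<le> dist x y"
    and lim: "\<And>x. x \<in> S \<Longrightarrow> (\<lambda>n. F n x) \<longlonglongrightarrow> x"
  shows "(\<lambda>n. F n x) \<longlonglongrightarrow> x"
proof (rule metric_LIMSEQ_I)
  fix e :: real assume e: "e > 0"
  obtain s where s: "s \<in> S" "dist s x < e / 3"
    using S e closure_approachable[of x S] by (metis UNIV_I divide_pos_pos zero_less_numeral)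
  obtain N where N: "\<And>n. n \<ge> N \<Longrightarrow> dist (F n s) s < e / 3"
    using metric_LIMSEQ_D[OF lim[OF s(1)], of "e / 3"] e by auto
  have "dist (F n x) x < e" if "n \<ge> N" for n
  proof -
    have "dist (F n x) x \<le> dist (F n x) (F n s) + dist (F n s) s + dist s x"
      using dist_triangle[of "F n x" x "F n s"] dist_triangle[of "F n s" x s] by linarith
    then show ?thesis using contr[of n x s] s(2) N[OF that] by (simp add: dist_commute)
  qed
  then show "\<exists>N. \<forall>n\<ge>N. dist (F n x) x < e" by blast
qed

lemma Cauchy_contractions_dense:
  fixes F :: "nat \<Rightarrow> 'a::metric_space \<Rightarrow> 'a"
  assumes S: "closure S = UNIV" and contr: "\<And>n x y. dist (F n x) (F n y) \<le> dist x y"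
    and lim: "\<And>x. x \<in> S \<Longrightarrow> Cauchy (\<lambda>n. F n x)"
  shows "Cauchy (\<lambda>n. F n x)"
proof (rule metric_CauchyI)
  fix e :: real assume e: "e > 0"
  obtain s where s: "s \<in> S" "dist s x < e / 3"
    using S e closure_approachable[of x S] by (metis UNIV_I divide_pos_pos zero_less_numeral)
  obtain N where N: "\<And>m n. m \<ge> N \<Longrightarrow> n \<ge> N \<Longrightarrow> dist (F m s) (F n s) < e / 3"
    using metric_CauchyD[OF lim[OF s(1)], of "e / 3"] e by auto
  have "dist (F m x) (F n x) < e" if "m \<ge> N" "n \<ge> N" for m n
  proof -
    have "dist (F m x) (F n x) \<le> dist (F m x) (F m s) + dist (F m s) (F n s) + dist (F n s) (F n x)"
      using dist_triangle[of "F m x" "F n x" "F m s"] dist_triangle[of "F m s" "F n x" "F n s"]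
      by linarith
    then show ?thesis
      using contr[of m x s] contr[of n s x] s(2) N[OF that] by (simp add: dist_commute)
  qed
  then show "\<exists>M. \<forall>m\<ge>M. \<forall>n\<ge>M. dist (F m x) (F n x) < e" by blast
qed

text \<open>The exponent is chosen so that \<open>eps\<close> is summable while \<open>\<Prod>j<k. eps j powr (- 1/2)\<close>
  is of lower order than \<open>fact k\<close>.\<close>

definition eps :: "nat \<Rightarrow> real" where "eps j = real (Suc j) powr (- 3/2)"

lemma eps_pos: "eps j > 0" by (simp add: eps_def)

lemma summable_eps: "summable eps"
proof -
  have "summable (\<lambda>n. real n powr (- 3/2))" by (simp add: summable_real_powr_iff)
  then show ?thesis by (subst (asm) summable_Suc_iff[symmetric]) (simp add: eps_def[abs_def])
qed

lemma eps_tail_tendsto_0: "(\<lambda>i. \<Sum>m. eps (i + m)) \<longlonglongrightarrow> 0"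
proof -
  have "(\<lambda>i. suminf eps - (\<Sum>j<i. eps j)) \<longlonglongrightarrow> suminf eps - suminf eps"
    by (intro tendsto_diff tendsto_const summable_LIMSEQ summable_eps)
  then show ?thesis
    using suminf_minus_initial_segment[OF summable_eps] by (simp add: add.commute)
qed

text \<open>This is \<open>eps j powr (- 1/2)\<close>, the bound that \<open>energy_bound\<close>
  gives for \<open>A\<close> after the resolvent at \<open>eps j\<close>. With exponent
  \<open>- s\<close> in \<open>eps\<close>, summability needs \<open>s > 1\<close>; the first
  \<open>k\<close> factors multiply to \<open>fact k powr (s/2)\<close>, which requires
  \<open>s < 2\<close>. The choice \<open>s = 3/2\<close> is the midpoint.\<close>

definition growth :: "nat \<Rightarrow> real" where "growth j = real (Suc j) powr (3/4)"

lemma growth_pos: "growth j > 0" by (simp add: growth_def)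

lemma growth_squared: "(growth j)\<^sup>2 * eps j = 1"
  unfolding growth_def eps_def power2_eq_square powr_add[symmetric] by simp

text \<open>The ratio of consecutive terms is of order \<open>k powr (- 1/4)\<close>, for every
  \<open>r\<close> and every shift \<open>i\<close>.\<close>

lemma summable_growth:
  "summable (\<lambda>k. r ^ k / fact k * (\<Prod>j<k. growth (i + j)))"
proof -
  have "(\<lambda>k. \<bar>r\<bar> * growth (i + k) / real (Suc k)) \<longlonglongrightarrow> 0"
    unfolding growth_def by real_asymp
  then have "\<forall>\<^sub>F k in sequentially. \<bar>r\<bar> * growth (i + k) / real (Suc k) < 1 / 2"
    by (rule order_tendstoD) simp
  then obtain K where K: "\<And>k. k \<ge> K \<Longrightarrow> \<bar>r\<bar> * growth (i + k) / real (Suc k) < 1 / 2"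
    by (auto simp: eventually_sequentially)
  show ?thesis
  proof (rule summable_ratio_test[of "1/2" K])
    fix k assume k: "K \<le> k"
    let ?f = "\<lambda>k. r ^ k / fact k * (\<Prod>j<k. growth (i + j))"
    have "norm (?f (Suc k)) = (\<bar>r\<bar> * growth (i + k) / real (Suc k)) * norm (?f k)"
      using growth_pos[of "i + k"]
      by (simp add: abs_mult power_abs divide_simps del: of_nat_Suc)
    also have "\<dots> \<le> 1 / 2 * norm (?f k)"
      using K[OF k] by (intro mult_right_mono) auto
    finally show "norm (?f (Suc k)) \<le> 1 / 2 * norm (?f k)" .
  qed simp
qed

text \<open>A normal operator and its adjoint as functions on their common domain, to be
  instantiated for both \<open>N\<close> and \<open>M\<close>. The assumption
  \<open>adj_maximal\<close> makes \<open>A'\<close> the full adjoint, not merely a formal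
  one.\<close>

locale normal_pair =
  fixes D :: "'a::chilbert_space set" and A A' :: "'a \<Rightarrow> 'a"
  assumes D: "csubspace D"
    and A_add: "x \<in> D \<Longrightarrow> y \<in> D \<Longrightarrow> A (x + y) = A x + A y"
    and A_scaleC: "x \<in> D \<Longrightarrow> A (scaleC c x) = scaleC c (A x)"
    and A'_add: "x \<in> D \<Longrightarrow> y \<in> D \<Longrightarrow> A' (x + y) = A' x + A' y"
    and A'_scaleC: "x \<in> D \<Longrightarrow> A' (scaleC c x) = scaleC c (A' x)"
    and adj: "x \<in> D \<Longrightarrow> y \<in> D \<Longrightarrow> cinner (A x) y = cinner x (A' y)"
    and adj_maximal: "(\<And>y. y \<in> D \<Longrightarrow> cinner (A y) x = cinner y z) \<Longrightarrow> x \<in> D \<and> A' x = z"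
    and closed: "(\<And>n. X n \<in> D) \<Longrightarrow> X \<longlonglongrightarrow> x \<Longrightarrow> (\<lambda>n. A (X n)) \<longlonglongrightarrow> y \<Longrightarrow> x \<in> D \<and> A x = y"
    and closed': "(\<And>n. X n \<in> D) \<Longrightarrow> X \<longlonglongrightarrow> x \<Longrightarrow> (\<lambda>n. A' (X n)) \<longlonglongrightarrow> y \<Longrightarrow> x \<in> D \<and> A' x = y"
    and comp_dom: "x \<in> D \<Longrightarrow> A x \<in> D \<longleftrightarrow> A' x \<in> D"
    and comm: "x \<in> D \<Longrightarrow> A x \<in> D \<Longrightarrow> A (A' x) = A' (A x)"
    and norm_eq: "x \<in> D \<Longrightarrow> norm (A' x) = norm (A x)"
    and surj: "e > 0 \<Longrightarrow> \<exists>x\<in>D. A x \<in> D \<and> x + e *\<^sub>R A' (A x) = z"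
begin

lemmas D_closed = csubspaceD[OF D]

lemma adj': "x \<in> D \<Longrightarrow> y \<in> D \<Longrightarrow> cinner (A' x) y = cinner x (A y)"
  using adj[of y x] by (metis cinner_cnj)

lemma A_scaleR: "x \<in> D \<Longrightarrow> A (r *\<^sub>R x) = r *\<^sub>R A x"
  by (simp add: scaleR_scaleC A_scaleC)

lemma A'_scaleR: "x \<in> D \<Longrightarrow> A' (r *\<^sub>R x) = r *\<^sub>R A' x"
  by (simp add: scaleR_scaleC A'_scaleC)

lemma A_diff: "x \<in> D \<Longrightarrow> y \<in> D \<Longrightarrow> A (x - y) = A x - A y"
  using A_add[of x "scaleC (-1) y"] D_closed(3)[of y "-1"] A_scaleC[of y "-1"] by (simp add: scaleC_minus1)

lemma A'_diff: "x \<in> D \<Longrightarrow> y \<in> D \<Longrightarrow> A' (x - y) = A' x - A' y"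
  using A'_add[of x "scaleC (-1) y"] D_closed(3)[of y "-1"] A'_scaleC[of y "-1"] by (simp add: scaleC_minus1)

lemma A_0 [simp]: "A 0 = 0" using A_add[of 0 0] D_closed(1) by simp
lemma A'_0 [simp]: "A' 0 = 0" using A'_add[of 0 0] D_closed(1) by simp

text \<open>Pairing the equation with \<open>x\<close> gives \<open>(norm x)\<^sup>2 + e * (norm (A
  x))\<^sup>2 = Re (cinner x z)\<close>, and Cauchy-Schwarz bounds the right side.\<close>

lemma energy_bound:
  assumes "e > 0" "x \<in> D" "A x \<in> D" "x + e *\<^sub>R A' (A x) = z"
  shows "norm x \<le> norm z" "e * (norm (A x))\<^sup>2 \<le> (norm z)\<^sup>2"
proof -
  have "cinner x (A' (A x)) = cinner (A x) (A x)" using assms by (simp add: adj)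
  then have "(norm x)\<^sup>2 + e * (norm (A x))\<^sup>2 = Re (cinner x z)"
    by (simp add: assms(4)[symmetric] cinner_add_right cinner_scaleR_right Re_cinner_self)
  also have "\<dots> \<le> norm x * norm z"
    using cauchy_schwarz[of x z] complex_Re_le_cmod order_trans by blast
  finally have *: "(norm x)\<^sup>2 + e * (norm (A x))\<^sup>2 \<le> norm x * norm z" .
  moreover have nn: "0 \<le> e * (norm (A x))\<^sup>2" using assms(1) by simp
  ultimately have "norm x * norm x \<le> norm x * norm z" by (simp add: power2_eq_square)
  then show 1: "norm x \<le> norm z"
    by (cases "x = 0") (auto simp: mult_le_cancel_left)
  have "e * (norm (A x))\<^sup>2 \<le> norm x * norm z" using * by (smt (verit) zero_le_power2)
  also have "\<dots> \<le> (norm z)\<^sup>2" using 1 by (simp add: power2_eq_square mult_right_mono)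
  finally show "e * (norm (A x))\<^sup>2 \<le> (norm z)\<^sup>2" .
qed

section \<open>Resolvents and their commutation with \<open>A\<close> and \<open>A'\<close>\<close>

definition resolvent :: "real \<Rightarrow> 'a \<Rightarrow> 'a" where
  "resolvent e z = (SOME x. x \<in> D \<and> A x \<in> D \<and> x + e *\<^sub>R A' (A x) = z)"

lemma resolvent:
  assumes "e > 0"
  shows "resolvent e z \<in> D" "A (resolvent e z) \<in> D"
    "resolvent e z + e *\<^sub>R A' (A (resolvent e z)) = z"
proof -
  have "\<exists>x. x \<in> D \<and> A x \<in> D \<and> x + e *\<^sub>R A' (A x) = z" using surj[OF assms, of z] by blast
  from someI_ex[OF this] show "resolvent e z \<in> D" "A (resolvent e z) \<in> D"
    "resolvent e z + e *\<^sub>R A' (A (resolvent e z)) = z" unfolding resolvent_def by blast+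
qed

text \<open>The difference of two solutions solves the equation with right side 0, where the energy
  bound annihilates it. Linearity and commutation below are all proved by exhibiting a
  solution.\<close>

lemma resolvent_unique:
  assumes "e > 0" "x \<in> D" "A x \<in> D" "x + e *\<^sub>R A' (A x) = z"
  shows "resolvent e z = x"
proof -
  let ?r = "resolvent e z"
  note r = resolvent[OF assms(1), of z]
  have d: "?r - x \<in> D" "A (?r - x) \<in> D"
    using r assms by (auto simp: A_diff D_closed)
  have "(?r - x) + e *\<^sub>R A' (A (?r - x)) = (?r + e *\<^sub>R A' (A ?r)) - (x + e *\<^sub>R A' (A x))"
    using r(1,2) assms(2,3) by (simp add: A_diff A'_diff algebra_simps)
  also have "\<dots> = 0" using r(3) assms(4) by simp
  finally have "(?r - x) + e *\<^sub>R A' (A (?r - x)) = 0" .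
  from energy_bound(1)[OF assms(1) d this] show ?thesis by simp
qed

lemma resolvent_add: "e > 0 \<Longrightarrow> resolvent e (x + y) = resolvent e x + resolvent e y"
proof (rule resolvent_unique)
  assume e: "e > 0"
  note r = resolvent[OF e, of x] resolvent[OF e, of y]
  have "resolvent e x + resolvent e y + e *\<^sub>R A' (A (resolvent e x + resolvent e y))
      = (resolvent e x + e *\<^sub>R A' (A (resolvent e x))) + (resolvent e y + e *\<^sub>R A' (A (resolvent e y)))"
    using r(1,2,4,5) by (simp add: A_add A'_add scaleR_add_right)
  then show "resolvent e x + resolvent e y + e *\<^sub>R A' (A (resolvent e x + resolvent e y)) = x + y"
    using r(3,6) by simp
qed (use resolvent[of e x] resolvent[of e y] in \<open>simp_all add: A_add D_closed\<close>)

lemma resolvent_scaleC: "e > 0 \<Longrightarrow> resolvent e (scaleC c x) = scaleC c (resolvent e x)"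
proof (rule resolvent_unique)
  assume e: "e > 0"
  note r = resolvent[OF e, of x]
  have "scaleC c (resolvent e x) + e *\<^sub>R A' (A (scaleC c (resolvent e x)))
      = scaleC c (resolvent e x + e *\<^sub>R A' (A (resolvent e x)))"
    using r(1,2) by (simp add: A_scaleC A'_scaleC scaleC_add_right scaleR_scaleC scaleC_scaleC mult.commute)
  then show "scaleC c (resolvent e x) + e *\<^sub>R A' (A (scaleC c (resolvent e x))) = scaleC c x"
    using r(3) by simp
qed (use resolvent[of e x] in \<open>simp_all add: A_scaleC D_closed\<close>)

lemma resolvent_diff: "e > 0 \<Longrightarrow> resolvent e (x - y) = resolvent e x - resolvent e y"
  using resolvent_add[of e x "scaleC (-1) y"] resolvent_scaleC[of e "-1" y] by (simp add: scaleC_minus1)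

lemma norm_resolvent_le: "e > 0 \<Longrightarrow> norm (resolvent e x) \<le> norm x"
  using energy_bound(1)[OF _ resolvent] .

text \<open>The defining equation expresses this vector through \<open>x\<close> and its resolvent,
  both in \<open>D\<close>. This extra regularity lets \<open>A\<close> and \<open>A'\<close> be
  applied to the whole equation.\<close>

lemma A'_A_resolvent_mem:
  assumes "e > 0" "x \<in> D"
  shows "A' (A (resolvent e x)) \<in> D"
proof -
  note r = resolvent[OF assms(1), of x]
  have "A' (A (resolvent e x)) = (1 / e) *\<^sub>R (x - resolvent e x)"
    using assms(1) by (subst (2) r(3)[symmetric]) simp
  then show ?thesis using assms r by (simp add: D_closed)
qed

lemma resolvent_A:
  assumes "e > 0" "x \<in> D"
  shows "resolvent e (A x) = A (resolvent e x)"
proof (rule resolvent_unique[OF assms(1)])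
  let ?r = "resolvent e x"
  note r = resolvent[OF assms(1), of x] and m = A'_A_resolvent_mem[OF assms]
  show "A ?r \<in> D" by (rule r)
  show AA: "A (A ?r) \<in> D" using comp_dom[OF r(2)] m by simp
  have "A ?r + e *\<^sub>R A' (A (A ?r)) = A (?r + e *\<^sub>R A' (A ?r))"
    using r(1,2) m comm[OF r(2) AA] by (simp add: A_add A_scaleR D_closed)
  then show "A ?r + e *\<^sub>R A' (A (A ?r)) = A x" using r(3) by simp
qed

lemma resolvent_A':
  assumes "e > 0" "x \<in> D"
  shows "resolvent e (A' x) = A' (resolvent e x)"
proof (rule resolvent_unique[OF assms(1)])
  let ?r = "resolvent e x"
  note r = resolvent[OF assms(1), of x] and m = A'_A_resolvent_mem[OF assms]
  show "A' ?r \<in> D" using comp_dom r by blast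
  show "A (A' ?r) \<in> D" using comm r m by simp
  have "A' ?r + e *\<^sub>R A' (A (A' ?r)) = A' (?r + e *\<^sub>R A' (A ?r))"
    using r(1,2) m comm[OF r(1,2)] by (simp add: A'_add A'_scaleR D_closed)
  then show "A' ?r + e *\<^sub>R A' (A (A' ?r)) = A' x" using r(3) by simp
qed

section \<open>Finite and infinite products of resolvents\<close>

primrec resolvents :: "nat \<Rightarrow> nat \<Rightarrow> 'a \<Rightarrow> 'a" where
  "resolvents i 0 x = x"
| "resolvents i (Suc m) x = resolvent (eps (i + m)) (resolvents i m x)"

text \<open>The recursion appends factors at the far end; splitting off the factor applied first is
  the form that survives the limit, in \<open>smooth_Suc\<close>.\<close>

lemma resolvents_Suc: "resolvents i (Suc m) x = resolvents (Suc i) m (resolvent (eps i) x)"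
  by (induction m) simp_all

lemma resolvents_add: "resolvents i m (x + y) = resolvents i m x + resolvents i m y"
  by (induction m) (simp_all add: resolvent_add eps_pos)

lemma resolvents_scaleC: "resolvents i m (scaleC c x) = scaleC c (resolvents i m x)"
  by (induction m) (simp_all add: resolvent_scaleC eps_pos)

lemma resolvents_diff: "resolvents i m (x - y) = resolvents i m x - resolvents i m y"
  by (induction m) (simp_all add: resolvent_diff eps_pos)

lemma norm_resolvents_le: "norm (resolvents i m x) \<le> norm x"
  by (induction m) (auto intro: order_trans[OF norm_resolvent_le[OF eps_pos]])

lemma resolvents_contraction: "dist (resolvents i m x) (resolvents i m y) \<le> dist x y"
  using norm_resolvents_le[of i m "x - y"] by (simp add: dist_norm resolvents_diff)

lemma resolvents_mem: "x \<in> D \<Longrightarrow> resolvents i m x \<in> D"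
  by (cases m) (auto simp: resolvent eps_pos)

lemma resolvents_A: "x \<in> D \<Longrightarrow> resolvents i m (A x) = A (resolvents i m x)"
  by (induction m) (simp_all add: resolvent_A eps_pos resolvents_mem)

lemma resolvents_A': "x \<in> D \<Longrightarrow> resolvents i m (A' x) = A' (resolvents i m x)"
  by (induction m) (simp_all add: resolvent_A' eps_pos resolvents_mem)

text \<open>A resolvent differs from the identity by \<open>- e A' A\<close> times the resolvent. On
  these \<open>x\<close> the operators \<open>A'\<close> and \<open>A\<close> move past all
  resolvents, which are contractions.\<close>

lemma resolvents_step:
  assumes x: "x \<in> D" "A x \<in> D"
  shows "norm (resolvents i (Suc m) x - resolvents i m x) \<le> eps (i + m) * norm (A' (A x))"
proof -
  define w where "w = resolvents i m x"
  have w: "w \<in> D" "A w \<in> D" "A' (A w) = resolvents i m (A' (A x))"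
    using x resolvents_mem by (simp_all add: w_def flip: resolvents_A resolvents_A')
  let ?e = "eps (i + m)"
  note r = resolvent(3)[OF eps_pos, of "i + m" w]
  have "resolvent ?e w - w = - (?e *\<^sub>R A' (A (resolvent ?e w)))"
    by (subst (2) r[symmetric]) simp
  then have "resolvents i (Suc m) x - resolvents i m x = - (?e *\<^sub>R A' (A (resolvent ?e w)))"
    by (simp add: w_def)
  also have "A' (A (resolvent ?e w)) = resolvent ?e (resolvents i m (A' (A x)))"
    using w by (simp add: resolvent_A[symmetric] resolvent_A'[symmetric] eps_pos)
  finally have "norm (resolvents i (Suc m) x - resolvents i m x)
      = ?e * norm (resolvent ?e (resolvents i m (A' (A x))))"
    by (simp add: less_imp_le[OF eps_pos])
  also have "\<dots> \<le> ?e * norm (A' (A x))"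
    using norm_resolvent_le[OF eps_pos] norm_resolvents_le order_trans
    by (intro mult_left_mono less_imp_le[OF eps_pos]) blast
  finally show ?thesis .
qed

text \<open>Write an orthogonal vector \<open>z\<close> as \<open>s + A' (A s)\<close>; pairing with
  \<open>s\<close> gives \<open>(norm s)\<^sup>2 + (norm (A s))\<^sup>2 = 0\<close>.\<close>

lemma dense_comp_dom: "closure {x \<in> D. A x \<in> D} = UNIV"
proof (rule orthogonal_complement_zero_imp_dense)
  show "csubspace {x \<in> D. A x \<in> D}"
    unfolding csubspace_def by (auto simp: A_add A_scaleC D_closed)
  fix z assume z: "\<And>s. s \<in> {x \<in> D. A x \<in> D} \<Longrightarrow> cinner s z = 0"
  obtain s where s: "s \<in> D" "A s \<in> D" "s + 1 *\<^sub>R A' (A s) = z" using surj[of 1 z] by auto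
  have "cinner s s + cinner (A s) (A s) = 0"
    using z[of s] s adj[of s "A s"] by (auto simp: cinner_add_right)
  then have "(norm s)\<^sup>2 + (norm (A s))\<^sup>2 = 0"
    unfolding cinner_self of_real_add[symmetric] by (simp only: of_real_eq_0_iff)
  then have "s = 0" by (simp add: sum_power2_eq_zero_iff)
  with s show "z = 0" by simp
qed

lemma resolvents_summable:
  assumes x: "x \<in> D" "A x \<in> D"
  shows "summable (\<lambda>m. norm (resolvents i (Suc m) x - resolvents i m x))"
    and "(\<Sum>m. norm (resolvents i (Suc m) x - resolvents i m x)) \<le> (\<Sum>m. eps (i + m)) * norm (A' (A x))"
proof -
  have e: "summable (\<lambda>m. eps (i + m))"
    using summable_ignore_initial_segment[OF summable_eps, of i] by (simp add: add.commute)
  then have e': "summable (\<lambda>m. eps (i + m) * norm (A' (A x)))" by (rule summable_mult2)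
  show 1: "summable (\<lambda>m. norm (resolvents i (Suc m) x - resolvents i m x))"
    by (rule summable_comparison_test'[OF e', of 0]) (use resolvents_step[OF x] in simp)
  show "(\<Sum>m. norm (resolvents i (Suc m) x - resolvents i m x)) \<le> (\<Sum>m. eps (i + m)) * norm (A' (A x))"
    unfolding suminf_mult2[OF e] by (intro suminf_le resolvents_step x 1 e')
qed

lemma resolvents_telescope:
  assumes x: "x \<in> D" "A x \<in> D"
  shows "(\<lambda>m. resolvents i m x) \<longlonglongrightarrow> x + (\<Sum>m. resolvents i (Suc m) x - resolvents i m x)"
proof -
  have "(\<lambda>n. x + (\<Sum>m<n. resolvents i (Suc m) x - resolvents i m x)) \<longlonglongrightarrow>
      x + (\<Sum>m. resolvents i (Suc m) x - resolvents i m x)"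
    by (intro tendsto_add tendsto_const summable_LIMSEQ summable_norm_cancel[OF resolvents_summable(1)[OF x]])
  moreover have "x + (\<Sum>m<n. resolvents i (Suc m) x - resolvents i m x) = resolvents i n x" for n
    using sum_lessThan_telescope[of "\<lambda>m. resolvents i m x" n] by (simp del: resolvents.simps(2))
  ultimately show ?thesis by simp
qed

definition smooth :: "nat \<Rightarrow> 'a \<Rightarrow> 'a" where
  "smooth i x = lim (\<lambda>m. resolvents i m x)"

text \<open>Telescoping gives convergence on the dense set where \<open>A' A\<close> is defined, and
  contractivity extends the Cauchy property to all \<open>x\<close>.\<close>

lemma resolvents_tendsto_smooth: "(\<lambda>m. resolvents i m x) \<longlonglongrightarrow> smooth i x"
proof -
  have "Cauchy (\<lambda>m. resolvents i m x)"
    by (rule Cauchy_contractions_dense[OF dense_comp_dom resolvents_contraction])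
       (auto dest: resolvents_telescope intro: LIMSEQ_imp_Cauchy)
  then show ?thesis
    unfolding smooth_def by (simp add: Cauchy_convergent_iff convergent_LIMSEQ_iff)
qed

lemma smooth_contraction: "dist (smooth i x) (smooth i y) \<le> dist x y"
proof (rule LIMSEQ_le)
  show "(\<lambda>m. dist (resolvents i m x) (resolvents i m y)) \<longlonglongrightarrow> dist (smooth i x) (smooth i y)"
    by (intro tendsto_dist resolvents_tendsto_smooth)
qed (use resolvents_contraction in auto)

lemma smooth_add: "smooth i (x + y) = smooth i x + smooth i y"
  using LIMSEQ_unique[OF resolvents_tendsto_smooth
      tendsto_add[OF resolvents_tendsto_smooth resolvents_tendsto_smooth, of i x i y, folded resolvents_add]] .

lemma smooth_scaleC: "smooth i (scaleC c x) = scaleC c (smooth i x)"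
  using LIMSEQ_unique[OF resolvents_tendsto_smooth
      bounded_linear.tendsto[OF bounded_linear_scaleC resolvents_tendsto_smooth, of c i x, folded resolvents_scaleC]] .

lemma norm_smooth_le: "norm (smooth i x) \<le> norm x"
  by (rule LIMSEQ_le_const2[OF tendsto_norm[OF resolvents_tendsto_smooth]])
     (use norm_resolvents_le in blast)

lemma smooth_A:
  assumes "x \<in> D"
  shows "smooth i x \<in> D" "A (smooth i x) = smooth i (A x)" "A' (smooth i x) = smooth i (A' x)"
proof -
  have "(\<lambda>m. A (resolvents i m x)) \<longlonglongrightarrow> smooth i (A x)"
    using resolvents_tendsto_smooth[of i "A x"] by (simp add: resolvents_A assms)
  from closed[OF resolvents_mem[OF assms] resolvents_tendsto_smooth this]
  show "smooth i x \<in> D" "A (smooth i x) = smooth i (A x)" by auto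
  have "(\<lambda>m. A' (resolvents i m x)) \<longlonglongrightarrow> smooth i (A' x)"
    using resolvents_tendsto_smooth[of i "A' x"] by (simp add: resolvents_A' assms)
  from closed'[OF resolvents_mem[OF assms] resolvents_tendsto_smooth this]
  show "A' (smooth i x) = smooth i (A' x)" by auto
qed

lemma smooth_Suc: "smooth i x = smooth (Suc i) (resolvent (eps i) x)"
  using LIMSEQ_unique[OF LIMSEQ_Suc[OF resolvents_tendsto_smooth, of i x, unfolded resolvents_Suc]
      resolvents_tendsto_smooth] .

text \<open>On the dense set the telescoped error is at most a tail of the series of
  \<open>eps\<close>, times \<open>norm (A' (A x))\<close>.\<close>

lemma smooth_tendsto: "(\<lambda>i. smooth i x) \<longlonglongrightarrow> x"
proof (rule tendsto_contractions_dense[OF dense_comp_dom smooth_contraction])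
  fix x assume "x \<in> {x \<in> D. A x \<in> D}"
  then have x: "x \<in> D" "A x \<in> D" by auto
  have "norm (smooth i x - x) \<le> (\<Sum>m. eps (i + m)) * norm (A' (A x))" for i
  proof -
    have "smooth i x = x + (\<Sum>m. resolvents i (Suc m) x - resolvents i m x)"
      by (rule LIMSEQ_unique[OF resolvents_tendsto_smooth resolvents_telescope[OF x]])
    then have "smooth i x - x = (\<Sum>m. resolvents i (Suc m) x - resolvents i m x)"
      by (metis add_diff_cancel_left')
    then show ?thesis
      by (metis order_trans[OF summable_norm[OF resolvents_summable(1)[OF x]] resolvents_summable(2)[OF x]])
  qed
  moreover have "(\<lambda>i. (\<Sum>m. eps (i + m)) * norm (A' (A x))) \<longlonglongrightarrow> 0"
    by (rule tendsto_mult_left_zero[OF eps_tail_tendsto_0])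
  ultimately have "(\<lambda>i. smooth i x - x) \<longlonglongrightarrow> 0"
    by (rule Lim_null_comparison[OF always_eventually[OF allI]])
  then show "(\<lambda>i. smooth i x) \<longlonglongrightarrow> x" by (rule LIM_zero_cancel)
qed

text \<open>Splitting off the resolvent applied first puts the argument into \<open>D\<close>, for
  arbitrary \<open>x\<close>.\<close>

lemma smooth_mem: "smooth i x \<in> D"
  and A_smooth: "A (smooth i x) = smooth (Suc i) (A (resolvent (eps i) x))"
  and A'_smooth: "A' (smooth i x) = smooth (Suc i) (A' (resolvent (eps i) x))"
  using smooth_A[OF resolvent(1)[OF eps_pos], of "Suc i" i x] unfolding smooth_Suc[of i x] by simp_all

section \<open>An invariant space of entire vectors\<close>

definition core :: "'a set" where "core = (\<Union>i. range (smooth i))"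

lemma range_smooth_mono: "i \<le> j \<Longrightarrow> range (smooth i) \<subseteq> range (smooth j)"
proof (induction j rule: dec_induct)
  case (step n)
  have "range (smooth n) \<subseteq> range (smooth (Suc n))"
    by (rule image_subsetI) (simp add: smooth_Suc[of n])
  with step.IH show ?case by (rule subset_trans)
qed (rule subset_refl)

lemma csubspace_core: "csubspace core"
  unfolding csubspace_def
proof (intro conjI ballI allI)
  show "0 \<in> core"
    unfolding core_def using norm_smooth_le[of 0 0] by (auto intro!: image_eqI[of _ _ 0])
next
  fix x y assume "x \<in> core" "y \<in> core"
  then obtain i j where "x \<in> range (smooth i)" "y \<in> range (smooth j)" by (auto simp: core_def)
  then have "x \<in> range (smooth (max i j))" "y \<in> range (smooth (max i j))"
    using range_smooth_mono[of i "max i j"] range_smooth_mono[of j "max i j"] by auto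
  then show "x + y \<in> core"
    unfolding core_def using smooth_add[symmetric] by blast
next
  fix c x assume "x \<in> core"
  then show "scaleC c x \<in> core"
    unfolding core_def using smooth_scaleC[symmetric] by blast
qed

lemmas core_closed = csubspaceD[OF csubspace_core]

lemma smooth_core: "smooth i x \<in> core" by (auto simp: core_def)

lemma core_mem: "x \<in> core \<Longrightarrow> x \<in> D" by (auto simp: core_def smooth_mem)

text \<open>By \<open>A_smooth\<close> an application of \<open>A\<close> raises the index by one;
  taking the union over all indices makes the space invariant.\<close>

lemma A_core: "x \<in> core \<Longrightarrow> A x \<in> core" unfolding core_def using A_smooth by blast

lemma A'_core: "x \<in> core \<Longrightarrow> A' x \<in> core" unfolding core_def using A'_smooth by blast

lemma core_comm: "x \<in> core \<Longrightarrow> A (A' x) = A' (A x)"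
  by (intro comm core_mem A_core)

lemma norm_funpow_A_smooth: "norm ((A ^^ k) (smooth i x)) \<le> (\<Prod>j<k. growth (i + j)) * norm x"
proof (induction k arbitrary: i x)
  case 0
  then show ?case by (simp add: norm_smooth_le)
next
  case (Suc k)
  let ?y = "A (resolvent (eps i) x)"
  have "eps i * (norm ?y)\<^sup>2 \<le> (norm x)\<^sup>2"
    by (rule energy_bound(2)[OF eps_pos resolvent[OF eps_pos]])
  then have "(growth i)\<^sup>2 * (eps i * (norm ?y)\<^sup>2) \<le> (growth i)\<^sup>2 * (norm x)\<^sup>2"
    by (rule mult_left_mono) simp
  then have "(norm ?y)\<^sup>2 \<le> (growth i * norm x)\<^sup>2"
    using growth_squared[of i] by (simp add: power_mult_distrib flip: mult.assoc)
  then have y: "norm ?y \<le> growth i * norm x"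
    by (rule power2_le_imp_le) (simp add: less_imp_le[OF growth_pos])
  have "norm ((A ^^ Suc k) (smooth i x)) = norm ((A ^^ k) (smooth (Suc i) ?y))"
    by (simp add: funpow_swap1 A_smooth)
  also have "\<dots> \<le> (\<Prod>j<k. growth (Suc i + j)) * norm ?y" by (rule Suc.IH)
  also have "\<dots> \<le> (\<Prod>j<k. growth (Suc i + j)) * (growth i * norm x)"
    by (intro mult_left_mono y prod_nonneg) (auto simp: less_imp_le[OF growth_pos])
  also have "\<dots> = (\<Prod>j<Suc k. growth (i + j)) * norm x"
    by (subst prod.lessThan_Suc_shift) simp
  finally show ?case .
qed

lemma core_entire:
  assumes "x \<in> core"
  shows "summable (\<lambda>k. r ^ k / fact k * norm ((A ^^ k) x))"
proof -
  obtain i z where x: "x = smooth i z" using assms by (auto simp: core_def)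
  show ?thesis
  proof (rule summable_comparison_test')
    show "summable (\<lambda>k. \<bar>r\<bar> ^ k / fact k * (\<Prod>j<k. growth (i + j)) * norm z)"
      by (intro summable_mult2 summable_growth)
    show "norm (r ^ k / fact k * norm ((A ^^ k) x))
        \<le> \<bar>r\<bar> ^ k / fact k * (\<Prod>j<k. growth (i + j)) * norm z" for k
      using norm_funpow_A_smooth[of k i z]
      by (simp add: x abs_mult power_abs divide_right_mono mult_left_mono mult.assoc)
  qed
qed

section \<open>Isometric exponentials of skew-symmetric combinations\<close>

definition skew :: "complex \<Rightarrow> 'a \<Rightarrow> 'a" where
  "skew l x = scaleC l (A x) - scaleC (cnj l) (A' x)"

lemma skew_core: "x \<in> core \<Longrightarrow> skew l x \<in> core"
  by (simp add: skew_def core_closed A_core A'_core)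

lemma funpow_skew_core: "x \<in> core \<Longrightarrow> (skew l ^^ k) x \<in> core"
  by (induction k) (auto simp: skew_core)

lemma skew_adj: "x \<in> core \<Longrightarrow> y \<in> core \<Longrightarrow> cinner (skew l x) y = - cinner x (skew l y)"
  by (simp add: skew_def cinner_diff_left cinner_diff_right cinner_scaleC_left cinner_scaleC_right
      adj adj' core_mem)

lemma funpow_skew_adj:
  assumes "x \<in> core" "y \<in> core"
  shows "cinner ((skew l ^^ k) x) y = (-1) ^ k * cinner x ((skew l ^^ k) y)"
  using assms(2)
  by (induction k arbitrary: y)
     (simp_all add: skew_adj funpow_skew_core assms(1) skew_core flip: funpow_swap1)

lemma norm_skew_le: "x \<in> core \<Longrightarrow> norm (skew l x) \<le> 2 * norm l * norm (A x)"
  using norm_triangle_ineq4[of "scaleC l (A x)" "scaleC (cnj l) (A' x)"]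
  by (simp add: skew_def norm_scaleC norm_eq core_mem)

lemma A_skew: "x \<in> core \<Longrightarrow> A (skew l x) = skew l (A x)"
  by (simp add: skew_def A_diff A_scaleC core_mem A_core A'_core core_closed core_comm)

lemma A_funpow_skew: "x \<in> core \<Longrightarrow> A ((skew l ^^ k) x) = (skew l ^^ k) (A x)"
  by (induction k) (simp_all add: A_skew funpow_skew_core)

text \<open>Normality gives \<open>A' x\<close> the norm of \<open>A x\<close>, so one factor
  \<open>skew l\<close> costs \<open>2 * norm l\<close> times one \<open>A\<close>; commutation with
  \<open>A\<close> allows induction.\<close>

lemma norm_funpow_skew_le:
  assumes "x \<in> core"
  shows "norm ((skew l ^^ k) x) \<le> (2 * norm l) ^ k * norm ((A ^^ k) x)"
  using assms
proof (induction k arbitrary: x)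
  case (Suc k)
  have "norm ((skew l ^^ Suc k) x) \<le> 2 * norm l * norm ((skew l ^^ k) (A x))"
    using norm_skew_le[OF funpow_skew_core[OF Suc.prems]] A_funpow_skew[OF Suc.prems] by simp
  also have "\<dots> \<le> 2 * norm l * ((2 * norm l) ^ k * norm ((A ^^ k) (A x)))"
    by (intro mult_left_mono Suc.IH A_core Suc.prems) auto
  finally show ?case by (simp add: funpow_swap1 mult.assoc)
qed simp

definition exp_term :: "complex \<Rightarrow> 'a \<Rightarrow> nat \<Rightarrow> 'a" where
  "exp_term l x k = (1 / fact k) *\<^sub>R (skew l ^^ k) x"

lemma summable_exp_term:
  assumes "x \<in> core"
  shows "summable (\<lambda>k. norm (exp_term l x k))"
proof (rule summable_comparison_test'[OF core_entire[OF assms, of "2 * norm l"]])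
  show "norm (norm (exp_term l x k)) \<le> (2 * norm l) ^ k / fact k * norm ((A ^^ k) x)" for k
    using norm_funpow_skew_le[OF assms, of k l]
    by (simp add: exp_term_def divide_right_mono)
qed

text \<open>Formally the inverse of the exponential is its adjoint. Concretely, in the Cauchy
  product of the series with itself all powers move to the right factor with sign
  \<open>(-1) ^ i\<close>, and the alternating binomial sum kills every degree
  \<open>k > 0\<close>.\<close>

lemma norm_suminf_exp_term:
  assumes x: "x \<in> core"
  shows "norm (\<Sum>k. exp_term l x k) = norm x"
proof -
  define u where "u = (\<Sum>k. exp_term l x k)"
  have u: "exp_term l x sums u"
    unfolding u_def by (intro summable_sums summable_norm_cancel[OF summable_exp_term[OF x]])
  have "(\<lambda>k. \<Sum>i\<le>k. cinner (exp_term l x i) (exp_term l x (k - i))) sums cinner u u"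
    by (intro bounded_bilinear.Cauchy_product_sums[OF bounded_bilinear_cinner] summable_exp_term x u)
  moreover have "(\<Sum>i\<le>k. cinner (exp_term l x i) (exp_term l x (k - i)))
      = (if k = 0 then cinner x x else 0)" for k
  proof -
    have "(\<Sum>i\<le>k. cinner (exp_term l x i) (exp_term l x (k - i)))
        = (\<Sum>i\<le>k. (-1) ^ i * of_nat (k choose i) * (cinner x ((skew l ^^ k) x) / fact k))"
    proof (rule sum.cong[OF refl])
      fix i assume "i \<in> {..k}"
      then have i: "i \<le> k" by simp
      have "cinner (exp_term l x i) (exp_term l x (k - i))
          = (-1) ^ i * cinner x ((skew l ^^ i) ((skew l ^^ (k - i)) x)) / (fact i * fact (k - i))"
        by (simp add: exp_term_def cinner_scaleR_left cinner_scaleR_right scaleR_conv_of_real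
            funpow_skew_adj funpow_skew_core x)
      also have "(skew l ^^ i) ((skew l ^^ (k - i)) x) = (skew l ^^ k) x"
        using i by (metis comp_apply funpow_add le_add_diff_inverse)
      finally show "cinner (exp_term l x i) (exp_term l x (k - i))
          = (-1) ^ i * of_nat (k choose i) * (cinner x ((skew l ^^ k) x) / fact k)"
        by (simp add: binomial_fact[OF i])
    qed
    also have "\<dots> = (if k = 0 then cinner x x else 0)"
      unfolding sum_distrib_right[symmetric] using choose_alternating_sum[of k, where 'a = complex] by simp
    finally show ?thesis .
  qed
  ultimately have "(\<lambda>k. if k = 0 then cinner x x else 0) sums cinner u u" by simp
  moreover have "(\<lambda>k. if k = 0 then cinner x x else 0) sums cinner x x"
    using sums_single[of 0 "\<lambda>_. cinner x x"] by simp
  ultimately have "cinner u u = cinner x x" by (rule sums_unique2)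
  then have "(norm u)\<^sup>2 = (norm x)\<^sup>2" by (metis Re_cinner_self)
  then show ?thesis by (simp add: u_def)
qed

end

lemma normal_op_imp_normal_pair:
  fixes N :: "'a::chilbert_space lop"
  assumes "normal_op N"
  shows "normal_pair (opdom N) (opapp N) (opapp (op_adjoint N))"
proof -
  have N: "densely_defined N" "closed_op N" using assms by (simp_all add: normal_op_def)
  note N' = closed_op_adjoint[OF N(1)]
  have lin: "linear_op N" "linear_op (op_adjoint N)" using N(2) N' by (simp_all add: closed_op_def)
  note dom = normal_op_adjoint_dom[OF assms(1)]
  show ?thesis
  proof
    show "csubspace (opdom N)" by (rule linear_opD[OF lin(1)])
    fix x :: 'a
    show "x \<in> opdom N \<Longrightarrow> opapp N x \<in> opdom N \<longleftrightarrow> opapp (op_adjoint N) x \<in> opdom N"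
      using normal_op_comm(1)[OF assms, of x] dom(1) by auto
    fix z
    show "x \<in> opdom N \<and> opapp (op_adjoint N) x = z"
      if "\<And>y. y \<in> opdom N \<Longrightarrow> cinner (opapp N y) x = cinner y z"
      using op_adjointI[OF N(1) that] dom(1) by simp
  next
    fix x y :: 'a and X :: "nat \<Rightarrow> 'a"
    assume X: "\<And>n. X n \<in> opdom N" "X \<longlonglongrightarrow> x"
    show "(\<lambda>n. opapp N (X n)) \<longlonglongrightarrow> y \<Longrightarrow> x \<in> opdom N \<and> opapp N x = y"
      using closed_opD[OF N(2), of X, OF X] by blast
    show "(\<lambda>n. opapp (op_adjoint N) (X n)) \<longlonglongrightarrow> y \<Longrightarrow> x \<in> opdom N \<and> opapp (op_adjoint N) x = y"
      using closed_opD[OF N', of X, unfolded dom, OF X] by blast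
  qed (use linear_opD[OF lin(1)] linear_opD[OF lin(2)] dom op_adjointD[OF N(1)] normal_op_comm[OF assms]
      one_plus_adjoint_comp_surj[OF N] in simp_all)
qed

section \<open>Relative boundedness\<close>

text \<open>By Baire, some sublevel set of \<open>norm (S x)\<close> is dense in a ball. Differences
  and scaling approximate every \<open>y\<close> by vectors with controlled image; iterating on the
  remainder writes \<open>y\<close> as a series, and closedness evaluates \<open>S y\<close> along
  it.\<close>

lemma closed_graph_bounded:
  fixes S :: "'a::banach \<Rightarrow> 'b::banach"
  assumes S: "linear S" and cl: "\<And>X x y. X \<longlonglongrightarrow> x \<Longrightarrow> (\<lambda>n. S (X n)) \<longlonglongrightarrow> y \<Longrightarrow> S x = y"
  shows "\<exists>C\<ge>0. \<forall>x. norm (S x) \<le> C * norm x"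
proof -
  interpret linear S by (rule S)
  define F where "F n = closure {x. norm (S x) \<le> real n}" for n
  have "\<Union>(range F) = UNIV"
  proof -
    have "x \<in> F (nat \<lceil>norm (S x)\<rceil>)" for x
      using closure_subset[of "{y. norm (S y) \<le> real (nat \<lceil>norm (S x)\<rceil>)}"]
      by (auto simp: F_def subset_iff)
    then show ?thesis by blast
  qed
  moreover have "interior (\<Union>(range F)) = {}" if none: "\<And>n. interior (F n) = {}"
  proof -
    have "Met_TC.mtopology interior_of \<Union>(range F) = {}"
    proof (rule Met_TC.metric_Baire_category_alt)
      show "Met_TC.mcomplete TYPE('a)" by (simp add: mcomplete_iff_complete complete_UNIV)
      show "closedin Met_TC.mtopology K \<and> Met_TC.mtopology interior_of K = {}" if "K \<in> range F" for K
        using that none by (auto simp: F_def)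
    qed simp
    then show ?thesis by simp
  qed
  ultimately obtain n where "interior (F n) \<noteq> {}"
    using interior_UNIV UNIV_not_empty by metis
  then obtain x0 r where r: "r > 0" "ball x0 r \<subseteq> F n"
    by (meson ex_in_conv mem_interior)
  \<comment> \<open>Below, \<open>t = r / (2 * norm y)\<close> scales \<open>y\<close> to norm
    \<open>r / 2\<close>, and \<open>norm (S u - S v)\<close> is at most \<open>2 * real n\<close>;
    the quotient of the two bounds is \<open>K * norm y\<close>.\<close>
  define K where "K = 4 * real n / r"
  have approx: "\<exists>x. norm (y - x) < d \<and> norm (S x) \<le> K * norm y" if d: "d > 0" for y d
  proof (cases "y = 0")
    case True
    then show ?thesis using d zero by (intro exI[of _ 0]) simp
  next
    case False
    define t where "t = r / (2 * norm y)"
    have t: "t > 0" using r False by (simp add: t_def)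
    define e where "e = t * d / 2"
    have e: "e > 0" using t d by (simp add: e_def)
    have "x0 + t *\<^sub>R y \<in> F n"
      using r False by (intro subsetD[OF r(2)]) (simp add: dist_norm t_def)
    then obtain u where u: "norm (S u) \<le> real n" "dist u (x0 + t *\<^sub>R y) < e"
      using e unfolding F_def closure_approachable by blast
    have "x0 \<in> F n" using r by (intro subsetD[OF r(2)]) simp
    then obtain v where v: "norm (S v) \<le> real n" "dist v x0 < e"
      using e unfolding F_def closure_approachable by blast
    define x where "x = (1 / t) *\<^sub>R (u - v)"
    have "y - x = (1 / t) *\<^sub>R ((v - x0) - (u - (x0 + t *\<^sub>R y)))"
      using t by (simp add: x_def algebra_simps)
    then have "norm (y - x) = norm ((v - x0) - (u - (x0 + t *\<^sub>R y))) / t"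
      using t by (simp add: divide_inverse mult.commute)
    also have "\<dots> < (e + e) / t"
      using u(2) v(2) t norm_triangle_ineq4[of "v - x0" "u - (x0 + t *\<^sub>R y)"]
      by (intro divide_strict_right_mono) (simp_all add: dist_norm)
    also have "\<dots> = d" using t by (simp add: e_def)
    finally have 1: "norm (y - x) < d" .
    have "norm (S x) = norm (S u - S v) / t"
      using t by (simp add: x_def scale diff divide_inverse mult.commute)
    also have "\<dots> \<le> (real n + real n) / t"
      using u(1) v(1) t norm_triangle_ineq4[of "S u" "S v"] by (intro divide_right_mono) simp_all
    also have "\<dots> = K * norm y" using r False by (simp add: K_def t_def)
    finally show ?thesis using 1 by blast
  qed
  have K0: "K \<ge> 0" using r by (simp add: K_def)
  have bound: "norm (S y) \<le> (2 * K) * norm y" for y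
  proof (cases "y = 0")
    case False
    obtain g where g: "\<And>d z. d > 0 \<Longrightarrow> norm (z - g d z) < d \<and> norm (S (g d z)) \<le> K * norm z"
      using approx by metis
    \<comment> \<open>\<open>Y k\<close> is what remains of \<open>y\<close> after \<open>k\<close>
      corrections. Its norm is at most \<open>norm y / 2 ^ k\<close>, and a correction costs at most
      \<open>K\<close> times the current remainder, so the costs sum to
      \<open>2 * K * norm y\<close>.\<close>
    define Y where "Y = rec_nat y (\<lambda>k z. z - g (norm y / 2 ^ Suc k) z)"
    have Y: "Y 0 = y" "\<And>k. Y (Suc k) = Y k - g (norm y / 2 ^ Suc k) (Y k)"
      by (simp_all add: Y_def)
    define x where "x k = g (norm y / 2 ^ Suc k) (Y k)" for k
    have pos: "norm y / 2 ^ Suc k > 0" for k using False by simp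
    have Yn: "norm (Y k) \<le> norm y / 2 ^ k" for k
    proof (cases k)
      case (Suc j)
      then show ?thesis using g[OF pos, of "Y j" j] by (simp add: Y(2) less_imp_le)
    qed (simp add: Y)
    have Sx: "norm (S (x k)) \<le> K * norm y * (1 / 2) ^ k" for k
      using g[OF pos, of "Y k" k] mult_left_mono[OF Yn[of k] K0]
      by (simp add: x_def power_divide)
    have geo: "summable (\<lambda>k. K * norm y * (1 / 2) ^ k)"
      by (intro summable_mult summable_geometric) simp
    have sumx: "(\<Sum>k<m. x k) = y - Y m" for m
      by (induction m) (simp_all add: Y x_def)
    have "Y \<longlonglongrightarrow> 0"
    proof (rule Lim_null_comparison)
      show "\<forall>\<^sub>F k in sequentially. norm (Y k) \<le> norm y / 2 ^ k" using Yn by simp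
      show "(\<lambda>k. norm y / 2 ^ k) \<longlonglongrightarrow> 0" by real_asymp
    qed
    then have "(\<lambda>m. y - Y m) \<longlonglongrightarrow> y - 0" by (intro tendsto_diff tendsto_const)
    moreover have sS: "summable (\<lambda>k. norm (S (x k)))"
      by (rule summable_comparison_test'[OF geo, of 0]) (use Sx in simp)
    have "(\<lambda>m. S (y - Y m)) \<longlonglongrightarrow> (\<Sum>k. S (x k))"
      using summable_LIMSEQ[OF summable_norm_cancel[OF sS]] by (simp add: sum flip: sumx)
    ultimately have "S y = (\<Sum>k. S (x k))" by (intro cl[of "\<lambda>m. y - Y m"]) simp_all
    also have "norm \<dots> \<le> (\<Sum>k. norm (S (x k)))" by (rule summable_norm[OF sS])
    also have "\<dots> \<le> (\<Sum>k. K * norm y * (1 / 2) ^ k)" by (intro suminf_le Sx sS geo)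
    also have "\<dots> = (2 * K) * norm y"
      by (subst suminf_mult) (simp_all add: suminf_geometric)
    finally show ?thesis .
  qed (simp add: zero)
  show ?thesis by (rule exI[of _ "2 * K"]) (use K0 bound in simp)
qed

text \<open>The closed graph theorem is applied to \<open>T\<close> composed with the orthogonal projection of
  \<open>H \<times> H\<close> onto the graph of \<open>N\<close>, which is everywhere defined.\<close>

lemma relatively_bounded:
  fixes T N :: "'a::chilbert_space lop"
  assumes T: "closed_op T" and N: "closed_op N" and dom: "opdom N \<subseteq> opdom T"
  shows "\<exists>C\<ge>0. \<forall>x\<in>opdom N. norm (opapp T x) \<le> C * (norm x + norm (opapp N x))"
proof -
  have lin: "linear_op T" "linear_op N" using T N by (simp_all add: closed_op_def)
  have "graph N = (\<lambda>x. (x, scaleC 1 (opapp N x))) ` opdom N"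
    by (auto simp: graph_def scaleC_one)
  then have G: "csubspace (graph N)"
    using csubspace_graph_restrict[OF lin(2) linear_opD(1)[OF lin(2)] order_refl, of 1] by simp
  have "\<exists>p\<in>graph N. \<forall>s\<in>graph N. cinner s (z - p) = 0" for z
    by (rule projection_exists[OF G]) (use N in \<open>simp add: closed_op_def\<close>)
  then obtain P where P: "\<And>z. P z \<in> graph N" "\<And>z s. s \<in> graph N \<Longrightarrow> cinner s (z - P z) = 0"
    by metis
  have unique: "P z = p" if "p \<in> graph N" "\<And>s. s \<in> graph N \<Longrightarrow> cinner s (z - p) = 0" for z p
  proof -
    have "P z - p \<in> graph N" using P(1) that(1) by (intro csubspaceD[OF G])
    with P(2)[of "P z - p" z] that(2)[of "P z - p"] have "cinner (P z - p) (P z - p) = 0"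
      by (simp add: cinner_diff_right)
    then show ?thesis by (simp add: cinner_eq_zero_iff)
  qed
  have P_add: "P (z + w) = P z + P w" for z w
  proof (rule unique)
    show "P z + P w \<in> graph N" by (intro csubspaceD[OF G] P)
    show "cinner s (z + w - (P z + P w)) = 0" if "s \<in> graph N" for s
      using P(2)[OF that, of z] P(2)[OF that, of w]
      by (simp add: cinner_diff_right cinner_add_right)
  qed
  have P_scaleR: "P (r *\<^sub>R z) = r *\<^sub>R P z" for r z
  proof (rule unique)
    show "r *\<^sub>R P z \<in> graph N" by (intro csubspaceD[OF G] P)
    show "cinner s (r *\<^sub>R z - r *\<^sub>R P z) = 0" if "s \<in> graph N" for s
      using P(2)[OF that, of z] by (simp add: cinner_scaleR_right flip: scaleR_diff_right)
  qed
  have P_norm: "norm (P z) \<le> norm z" for z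
  proof -
    have "(norm z)\<^sup>2 = (norm (P z))\<^sup>2 + (norm (z - P z))\<^sup>2"
      using norm_add_squared[of "P z" "z - P z"] P(2)[OF P(1), of z z] by simp
    then have "(norm (P z))\<^sup>2 \<le> (norm z)\<^sup>2" by simp
    then show ?thesis by simp
  qed
  have P_lin: "bounded_linear P"
    using P_norm by (intro bounded_linear_intro[of _ 1] P_add P_scaleR) simp
  have PD: "fst (P z) \<in> opdom T" for z using P(1)[of z] dom by (auto simp: graph_def)
  define S where "S z = opapp T (fst (P z))" for z
  have "linear S"
    by (rule linearI)
       (simp_all add: S_def P_add P_scaleR linear_opD(2)[OF lin(1)] linear_opD(3)[OF lin(1)] PD
         scaleR_scaleC[of _ "opapp T _"] scaleR_scaleC[of _ "fst _"])
  moreover have "S x = y" if "X \<longlonglongrightarrow> x" "(\<lambda>n. S (X n)) \<longlonglongrightarrow> y" for X x y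
  proof -
    have "(\<lambda>n. fst (P (X n))) \<longlonglongrightarrow> fst (P x)"
      by (intro tendsto_fst bounded_linear.tendsto[OF P_lin] that)
    from closed_opD(2)[OF T _ this, of y] that(2) PD show ?thesis by (simp add: S_def)
  qed
  ultimately obtain C where C: "C \<ge> 0" "\<And>z. norm (S z) \<le> C * norm z"
    using closed_graph_bounded[of S] by blast
  have "norm (opapp T x) \<le> C * (norm x + norm (opapp N x))" if x: "x \<in> opdom N" for x
  proof -
    have "P (x, opapp N x) = (x, opapp N x)"
      by (rule unique) (use x in \<open>auto simp: graph_def\<close>)
    then have "norm (opapp T x) \<le> C * norm (x, opapp N x)"
      using C(2)[of "(x, opapp N x)"] by (simp add: S_def)
    also have "\<dots> \<le> C * (norm x + norm (opapp N x))"
      by (intro mult_left_mono C norm_Pair_le)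
    finally show ?thesis .
  qed
  with C(1) show ?thesis by blast
qed

section \<open>The Fuglede--Putnam argument\<close>

text \<open>Binomial expansion via Pascal's rule. The induction varies \<open>f\<close>, since the
  innermost derivation is absorbed into it; thus no additivity of \<open>f\<close> enters.\<close>

lemma iterated_derivation_Leibniz:
  fixes f :: "'a \<Rightarrow> 'b \<Rightarrow> 'c::comm_semiring_1" and a :: "'a \<Rightarrow> 'a" and b :: "'b \<Rightarrow> 'b"
  shows "((\<lambda>f x y. f (a x) y + f x (b y)) ^^ k) f x y
    = (\<Sum>i\<le>k. of_nat (k choose i) * f ((a ^^ i) x) ((b ^^ (k - i)) y))"
proof (induction k arbitrary: f)
  case (Suc k)
  define g where "g i = f ((a ^^ i) x) ((b ^^ (Suc k - i)) y)" for i
  have g: "f (a ((a ^^ i) x)) ((b ^^ (k - i)) y) = g (Suc i)"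
      "i \<le> k \<Longrightarrow> f ((a ^^ i) x) (b ((b ^^ (k - i)) y)) = g i" for i
    by (simp_all add: g_def Suc_diff_le)
  have 1: "((\<lambda>f x y. f (a x) y + f x (b y)) ^^ Suc k) f x y
      = (\<Sum>i\<le>k. of_nat (k choose i) * g (Suc i)) + (\<Sum>i\<le>k. of_nat (k choose i) * g i)"
    by (simp add: funpow_Suc_right Suc.IH g distrib_left sum.distrib del: funpow.simps(2))
  have "(\<Sum>i\<le>k. of_nat (k choose i) * g i) = (\<Sum>i\<le>Suc k. of_nat (k choose i) * g i)"
    by (simp add: binomial_eq_0)
  also have "\<dots> = g 0 + (\<Sum>i\<le>k. of_nat (k choose Suc i) * g (Suc i))"
    by (subst sum.atMost_Suc_shift) simp
  finally have 2: "(\<Sum>i\<le>k. of_nat (k choose i) * g i)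
      = g 0 + (\<Sum>i\<le>k. of_nat (k choose Suc i) * g (Suc i))" .
  have 3: "(\<Sum>i\<le>Suc k. of_nat (Suc k choose i) * g i)
      = g 0 + ((\<Sum>i\<le>k. of_nat (k choose i) * g (Suc i)) + (\<Sum>i\<le>k. of_nat (k choose Suc i) * g (Suc i)))"
    by (subst sum.atMost_Suc_shift) (simp add: distrib_right sum.distrib)
  show ?case
    unfolding 1 using 2 3 by (simp only: g_def add_ac)
qed simp

text \<open>The relation is recorded where \<open>A x\<close> stays in \<open>D\<close>, so that
  only values of \<open>T\<close> controlled by \<open>T_bound\<close> occur. Vectors whose image
  under \<open>N\<close> lies in the domain of \<open>T\<close> but outside \<open>D\<close> return
  in the final theorem.\<close>

locale intertwining = N: normal_pair D A A' + M: normal_pair E B B'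
  for D :: "'a::chilbert_space set" and A A' and E :: "'a set" and B B' +
  fixes T :: "'a \<Rightarrow> 'a" and C :: real
  assumes T_add: "x \<in> D \<Longrightarrow> y \<in> D \<Longrightarrow> T (x + y) = T x + T y"
    and T_scaleC: "x \<in> D \<Longrightarrow> T (scaleC c x) = scaleC c (T x)"
    and T_bound: "x \<in> D \<Longrightarrow> norm (T x) \<le> C * (norm x + norm (A x))"
    and C_nonneg: "C \<ge> 0"
    and intertwine: "x \<in> D \<Longrightarrow> A x \<in> D \<Longrightarrow> T x \<in> E \<and> B (T x) = T (A x)"
begin

lemma T_diff: "x \<in> D \<Longrightarrow> y \<in> D \<Longrightarrow> T (x - y) = T x - T y"
  using T_add[of x "scaleC (-1) y"] N.D_closed(3)[of y "-1"] T_scaleC[of y "-1"]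
  by (simp add: scaleC_minus1)

lemma T_0: "T 0 = 0"
  using T_diff[of 0 0] N.D_closed(1) by simp

lemma T_scaleR: "x \<in> D \<Longrightarrow> T (r *\<^sub>R x) = r *\<^sub>R T x"
  by (simp add: scaleR_scaleC T_scaleC)

lemma T_tendsto:
  assumes "\<And>n. X n \<in> D" "x \<in> D" "X \<longlonglongrightarrow> x" "(\<lambda>n. A (X n)) \<longlonglongrightarrow> A x"
  shows "(\<lambda>n. T (X n)) \<longlonglongrightarrow> T x"
proof (rule LIM_zero_cancel, rule Lim_null_comparison)
  show "\<forall>\<^sub>F n in sequentially. norm (T (X n) - T x) \<le> C * (norm (X n - x) + norm (A (X n) - A x))"
    using T_bound[of "X _ - x"] assms(1,2)
    by (intro always_eventually allI) (simp add: T_diff N.A_diff N.D_closed)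
  have "(\<lambda>n. C * (norm (X n - x) + norm (A (X n) - A x))) \<longlonglongrightarrow> C * (0 + 0)"
    by (intro tendsto_mult tendsto_const tendsto_add tendsto_norm_zero LIM_zero assms)
  then show "(\<lambda>n. C * (norm (X n - x) + norm (A (X n) - A x))) \<longlonglongrightarrow> 0" by simp
qed

text \<open>Models \<open>cinner (T x) y\<close>, conjugate linear in \<open>x\<close>. The first
  clause is \<open>T A = B T\<close> in weak form, and additivity is stated for differences because
  \<open>skew\<close> is one.\<close>

definition intertwining_form :: "('a \<Rightarrow> 'a \<Rightarrow> complex) \<Rightarrow> bool" where
  "intertwining_form f \<longleftrightarrow> (\<forall>x\<in>N.core. \<forall>y\<in>M.core. f (A x) y = f x (B' y)
     \<and> (\<forall>x'\<in>N.core. f (x - x') y = f x y - f x' y) \<and> (\<forall>y'\<in>M.core. f x (y - y') = f x y - f x y')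
     \<and> (\<forall>c. f (scaleC c x) y = cnj c * f x y \<and> f x (scaleC c y) = c * f x y))"

text \<open>For \<open>f x y = cinner (T x) y\<close> this is the weak form of
  \<open>B' T - T A'\<close>, whose vanishing is the aim.\<close>

definition commutator :: "('a \<Rightarrow> 'a \<Rightarrow> complex) \<Rightarrow> ('a \<Rightarrow> 'a \<Rightarrow> complex)" where
  "commutator f x y = f x (B y) - f (A' x) y"

lemmas cores = N.core_mem N.A_core N.A'_core N.core_closed M.core_mem M.A_core M.A'_core M.core_closed

text \<open>Normality on both sides enters here: \<open>B'\<close> must pass \<open>B\<close>, and
  \<open>A\<close> must pass \<open>A'\<close>.\<close>

lemma intertwining_form_commutator: "intertwining_form f \<Longrightarrow> intertwining_form (commutator f)"
  unfolding intertwining_form_def commutator_def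
  by (simp add: cores M.core_comm N.core_comm[symmetric] M.A_diff M.A_scaleC N.A'_diff N.A'_scaleC
      algebra_simps)

definition skew_derivation :: "complex \<Rightarrow> ('a \<Rightarrow> 'a \<Rightarrow> complex) \<Rightarrow> ('a \<Rightarrow> 'a \<Rightarrow> complex)" where
  "skew_derivation l = (\<lambda>f x y. f (N.skew l x) y + f x (M.skew l y))"

text \<open>The two terms with coefficient \<open>cnj l\<close> cancel by the intertwining relation.
  Only \<open>l\<close> itself survives, which makes the function in Liouville's theorem
  holomorphic.\<close>

lemma skew_derivation_eq_commutator:
  assumes "intertwining_form f" "x \<in> N.core" "y \<in> M.core"
  shows "skew_derivation l f x y = l * commutator f x y"
  using assms unfolding intertwining_form_def commutator_def skew_derivation_def N.skew_def M.skew_def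
  by (simp add: cores right_diff_distrib)

lemma funpow_skew_derivation:
  assumes f: "intertwining_form f" and xy: "x \<in> N.core" "y \<in> M.core"
  shows "(skew_derivation l ^^ k) f x y = l ^ k * (commutator ^^ k) f x y"
  using xy
proof (induction k arbitrary: x y)
  case (Suc k)
  have form: "intertwining_form ((commutator ^^ k) f)"
    by (induction k) (auto intro: intertwining_form_commutator f)
  have "(skew_derivation l ^^ Suc k) f x y = l ^ k * skew_derivation l ((commutator ^^ k) f) x y"
    using Suc by (simp add: skew_derivation_def distrib_left N.skew_core M.skew_core)
  then show ?case
    by (simp add: skew_derivation_eq_commutator[OF form Suc.prems])
qed simp

lemma intertwining_form_T: "intertwining_form (\<lambda>x y. cinner (T x) y)"
proof -
  have "cinner (T (A x)) y = cinner (T x) (B' y)" if "x \<in> N.core" "y \<in> M.core" for x y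
    using intertwine[of x] M.adj[of "T x" y] that by (simp add: cores)
  then show ?thesis
    unfolding intertwining_form_def
    by (simp add: cores T_diff T_scaleC cinner_diff_left cinner_diff_right
        cinner_scaleC_left cinner_scaleC_right)
qed

lemma exp_term_mem: "x \<in> N.core \<Longrightarrow> N.exp_term l x k \<in> N.core"
  by (simp add: N.exp_term_def N.core_closed N.funpow_skew_core)

lemma A_exp_term: "x \<in> N.core \<Longrightarrow> A (N.exp_term l x k) = N.exp_term l (A x) k"
  by (simp add: N.exp_term_def N.A_scaleR cores N.A_funpow_skew N.funpow_skew_core)

lemma summable_T_exp_term:
  assumes x: "x \<in> N.core"
  shows "summable (\<lambda>k. norm (T (N.exp_term l x k)))"
proof (rule summable_comparison_test')
  show "summable (\<lambda>k. C * (norm (N.exp_term l x k) + norm (N.exp_term l (A x) k)))"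
    by (intro summable_mult summable_add N.summable_exp_term N.A_core x)
  show "norm (norm (T (N.exp_term l x k))) \<le> C * (norm (N.exp_term l x k) + norm (N.exp_term l (A x) k))" for k
    using T_bound[OF N.core_mem[OF exp_term_mem[OF x]]] by (simp add: A_exp_term x)
qed

text \<open>The exponential series commutes with \<open>A\<close> and is isometric, so its partial
  sums are controlled in the graph norm; \<open>T_bound\<close> carries this to the limit.\<close>

lemma norm_suminf_T_exp_term:
  assumes x: "x \<in> N.core"
  shows "norm (\<Sum>k. T (N.exp_term l x k)) \<le> C * (norm x + norm (A x))"
proof (rule LIMSEQ_le)
  have s: "(\<lambda>n. \<Sum>k<n. N.exp_term l z k) \<longlonglongrightarrow> (\<Sum>k. N.exp_term l z k)" if "z \<in> N.core" for z
    by (rule summable_LIMSEQ[OF summable_norm_cancel[OF N.summable_exp_term[OF that]]])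
  show "(\<lambda>n. norm (\<Sum>k<n. T (N.exp_term l x k))) \<longlonglongrightarrow> norm (\<Sum>k. T (N.exp_term l x k))"
    by (intro tendsto_norm summable_LIMSEQ summable_norm_cancel[OF summable_T_exp_term[OF x]])
  have "(\<lambda>n. C * (norm (\<Sum>k<n. N.exp_term l x k) + norm (\<Sum>k<n. N.exp_term l (A x) k)))
      \<longlonglongrightarrow> C * (norm (\<Sum>k. N.exp_term l x k) + norm (\<Sum>k. N.exp_term l (A x) k))"
    by (intro tendsto_mult tendsto_const tendsto_add tendsto_norm s x N.A_core)
  then show "(\<lambda>n. C * (norm (\<Sum>k<n. N.exp_term l x k) + norm (\<Sum>k<n. N.exp_term l (A x) k)))
      \<longlonglongrightarrow> C * (norm x + norm (A x))"
    by (simp add: N.norm_suminf_exp_term x N.A_core)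
  have "norm (\<Sum>k<n. T (N.exp_term l x k))
      \<le> C * (norm (\<Sum>k<n. N.exp_term l x k) + norm (\<Sum>k<n. N.exp_term l (A x) k))" for n
  proof -
    have mem: "(\<Sum>k<n. N.exp_term l x k) \<in> D" for n
      by (intro csubspace_sum[OF N.D] N.core_mem exp_term_mem x)
    have "T (\<Sum>k<n. N.exp_term l x k) = (\<Sum>k<n. T (N.exp_term l x k))"
      by (induction n) (simp_all add: T_0 T_add mem N.core_mem exp_term_mem x)
    moreover have "A (\<Sum>k<n. N.exp_term l x k) = (\<Sum>k<n. N.exp_term l (A x) k)"
      by (induction n) (simp_all add: N.A_add mem N.core_mem exp_term_mem x A_exp_term)
    ultimately show ?thesis using T_bound[OF mem] by metis
  qed
  then show "\<exists>m. \<forall>n\<ge>m. norm (\<Sum>k<n. T (N.exp_term l x k))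
      \<le> C * (norm (\<Sum>k<n. N.exp_term l x k) + norm (\<Sum>k<n. N.exp_term l (A x) k))" by blast
qed

text \<open>The entire function below is formally \<open>\<langle>T exp (- cnj l N\<^sup>*) x, exp (l M) y\<rangle>\<close>. By the
  intertwining relation the exponents may be completed to the skew-adjoint \<open>l N - cnj l N\<^sup>*\<close> and
  \<open>l M - cnj l M\<^sup>*\<close>, whose exponentials are isometric, so it is bounded; Liouville's theorem
  annihilates its linear coefficient.\<close>

lemma commutator_T_eq_0:
  assumes x: "x \<in> N.core" and y: "y \<in> M.core"
  shows "commutator (\<lambda>x y. cinner (T x) y) x y = 0"
proof -
  let ?f = "\<lambda>x y. cinner (T x) y"
  define c where "c k = (commutator ^^ k) ?f x y / fact k" for k
  define a where "a l k = T (N.exp_term l x k)" for l k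
  define b where "b l k = M.exp_term l y k" for l k
  \<comment> \<open>By Leibniz the degree \<open>k\<close> part of the Cauchy product is the
    \<open>k\<close>-th iterated skew derivation over \<open>fact k\<close>, hence a pure monomial
    in \<open>l\<close>.\<close>
  have coeff: "(\<Sum>i\<le>k. cinner (a l i) (b l (k - i))) = c k * l ^ k" for l k
  proof -
    have "(\<Sum>i\<le>k. cinner (a l i) (b l (k - i)))
        = (\<Sum>i\<le>k. of_nat (k choose i) * ?f ((N.skew l ^^ i) x) ((M.skew l ^^ (k - i)) y) / fact k)"
    proof (rule sum.cong[OF refl])
      fix i assume "i \<in> {..k}"
      then have "i \<le> k" by simp
      then show "cinner (a l i) (b l (k - i))
          = of_nat (k choose i) * ?f ((N.skew l ^^ i) x) ((M.skew l ^^ (k - i)) y) / fact k"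
        by (simp add: a_def b_def N.exp_term_def M.exp_term_def T_scaleR cores N.funpow_skew_core x
            cinner_scaleR_left cinner_scaleR_right scaleR_conv_of_real binomial_fact)
    qed
    also have "\<dots> = (skew_derivation l ^^ k) ?f x y / fact k"
      unfolding skew_derivation_def iterated_derivation_Leibniz by (rule sum_divide_distrib[symmetric])
    also have "\<dots> = c k * l ^ k"
      by (simp add: funpow_skew_derivation[OF intertwining_form_T x y] c_def)
    finally show ?thesis .
  qed
  have sums: "(\<lambda>k. c k * l ^ k) sums cinner (\<Sum>k. a l k) (\<Sum>k. b l k)" for l
    unfolding coeff[symmetric] a_def b_def
    by (intro bounded_bilinear.Cauchy_product_sums[OF bounded_bilinear_cinner] summable_sums
        summable_T_exp_term M.summable_exp_term x y
        summable_norm_cancel[OF summable_T_exp_term[OF x]] summable_norm_cancel[OF M.summable_exp_term[OF y]])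
  define F where "F l = (\<Sum>k. c k * l ^ k)" for l
  have deriv: "(F has_field_derivative (\<Sum>k. diffs c k * l ^ k)) (at l)" for l
    unfolding F_def[abs_def] using sums by (intro termdiffs_strong_converges_everywhere) (rule sums_summable)
  have "F constant_on UNIV"
  proof (rule Liouville_theorem)
    show "F holomorphic_on UNIV"
      using deriv by (auto simp: holomorphic_on_open)
    have "norm (F l) \<le> C * (norm x + norm (A x)) * norm y" for l
    proof -
      have "norm (F l) \<le> norm (\<Sum>k. a l k) * norm (\<Sum>k. b l k)"
        using sums_unique[OF sums[of l]] cauchy_schwarz unfolding F_def by metis
      also have "norm (\<Sum>k. b l k) = norm y" by (simp add: b_def M.norm_suminf_exp_term y)
      finally show ?thesis
        using norm_suminf_T_exp_term[OF x, of l] unfolding a_def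
        by (meson mult_right_mono norm_ge_zero order_trans)
    qed
    then show "bounded (range F)" by (auto simp: bounded_iff)
  qed
  then obtain d where "F = (\<lambda>_. d)" by (auto simp: constant_on_def)
  \<comment> \<open>This is the derivative of the constant \<open>F\<close> at 0; its only surviving
    term is \<open>diffs c 0 = c 1\<close>, the commutator.\<close>
  then have "(\<Sum>k. diffs c k * 0 ^ k) = 0"
    using DERIV_unique[OF deriv[of 0]] DERIV_const by blast
  then have "c 1 = 0" by (simp add: diffs_def)
  then show ?thesis by (simp add: c_def)
qed

text \<open>The vanishing commutator tests only against \<open>M.core\<close>. For \<open>y\<close>
  in \<open>E\<close>, both \<open>M.smooth i y\<close> and its image under \<open>B\<close>
  converge, to \<open>y\<close> and \<open>B y\<close>, so the identity holds against all of
  \<open>E\<close> and maximality of the adjoint applies.\<close>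

lemma adjoint_intertwine_core:
  assumes x: "x \<in> N.core"
  shows "T x \<in> E \<and> B' (T x) = T (A' x)"
proof (rule M.adj_maximal)
  fix y assume y: "y \<in> E"
  have "cinner (B (M.smooth i y)) (T x) = cinner (M.smooth i y) (T (A' x))" for i
    using commutator_T_eq_0[OF x M.smooth_core] by (metis cinner_cnj commutator_def eq_iff_diff_eq_0)
  then have eq: "cinner (M.smooth i (B y)) (T x) = cinner (M.smooth i y) (T (A' x))" for i
    using y by (simp add: M.smooth_A)
  show "cinner (B y) (T x) = cinner y (T (A' x))"
  proof (rule LIMSEQ_unique)
    show "(\<lambda>i. cinner (M.smooth i (B y)) (T x)) \<longlonglongrightarrow> cinner (B y) (T x)"
      by (intro tendsto_cinner M.smooth_tendsto tendsto_const)
    show "(\<lambda>i. cinner (M.smooth i (B y)) (T x)) \<longlonglongrightarrow> cinner y (T (A' x))"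
      unfolding eq by (intro tendsto_cinner M.smooth_tendsto tendsto_const)
  qed
qed

lemma T_smooth_tendsto:
  assumes "x \<in> D"
  shows "(\<lambda>i. T (N.smooth i x)) \<longlonglongrightarrow> T x"
  using assms N.smooth_tendsto[of "A x"]
  by (intro T_tendsto N.smooth_tendsto) (simp_all add: N.smooth_A)

text \<open>With \<open>x\<close> and \<open>A' x\<close> both in \<open>D\<close>, \<open>T\<close>
  converges along the smoothings of each, and \<open>B'\<close> is closed. This case suffices for
  comparing resolvents.\<close>

lemma adjoint_intertwine:
  assumes x: "x \<in> D" "A' x \<in> D"
  shows "T x \<in> E \<and> B' (T x) = T (A' x)"
proof (rule M.closed')
  show "T (N.smooth i x) \<in> E" for i using adjoint_intertwine_core[OF N.smooth_core] by simp
  show "(\<lambda>i. T (N.smooth i x)) \<longlonglongrightarrow> T x" by (rule T_smooth_tendsto[OF x(1)])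
  show "(\<lambda>i. B' (T (N.smooth i x))) \<longlonglongrightarrow> T (A' x)"
    using adjoint_intertwine_core[OF N.smooth_core] T_smooth_tendsto[OF x(2)] x(1)
    by (simp add: N.smooth_A)
qed

text \<open>Apply \<open>T\<close> to the equation for the resolvent \<open>r\<close> of
  \<open>x\<close>: since \<open>T (A' (A r)) = B' (T (A r)) = B' (B (T r))\<close>, the vector
  \<open>T r\<close> solves the equation of \<open>M\<close> at \<open>T x\<close>.\<close>

lemma T_resolvent:
  assumes e: "e > 0" and x: "x \<in> D"
  shows "T (N.resolvent e x) = M.resolvent e (T x)"
proof (rule sym, rule M.resolvent_unique[OF e])
  let ?r = "N.resolvent e x"
  note r = N.resolvent[OF e, of x] and m = N.A'_A_resolvent_mem[OF e x]
  have 1: "T ?r \<in> E" "B (T ?r) = T (A ?r)" using intertwine r by auto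
  have 2: "T (A ?r) \<in> E" "B' (T (A ?r)) = T (A' (A ?r))" using adjoint_intertwine r m by auto
  show "T ?r \<in> E" "B (T ?r) \<in> E" using 1 2 by simp_all
  have "T ?r + e *\<^sub>R B' (B (T ?r)) = T (?r + e *\<^sub>R A' (A ?r))"
    using 1 2 r(1,2) m by (simp add: T_add T_scaleR N.D_closed)
  then show "T ?r + e *\<^sub>R B' (B (T ?r)) = T x" using r(3) by simp
qed

lemma T_resolvents: "x \<in> D \<Longrightarrow> T (N.resolvents i m x) = M.resolvents i m (T x)"
  by (induction m) (simp_all add: T_resolvent eps_pos N.resolvents_mem)

lemma T_smooth:
  assumes x: "x \<in> D"
  shows "T (N.smooth i x) = M.smooth i (T x)"
proof (rule LIMSEQ_unique[OF _ M.resolvents_tendsto_smooth])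
  have "(\<lambda>m. T (N.resolvents i m x)) \<longlonglongrightarrow> T (N.smooth i x)"
    using N.resolvents_tendsto_smooth[of i "A x"] x
    by (intro T_tendsto N.resolvents_tendsto_smooth)
       (simp_all add: N.resolvents_mem N.smooth_A N.resolvents_A)
  then show "(\<lambda>m. M.resolvents i m (T x)) \<longlonglongrightarrow> T (N.smooth i x)"
    by (simp add: T_resolvents x)
qed

text \<open>The value is stated as \<open>B (T y)\<close> because \<open>A' x\<close> may lie
  outside \<open>D\<close>, where the locale says nothing about \<open>T\<close>.\<close>

lemma adjoint_intertwine_range:
  assumes x: "x \<in> D" and y: "y \<in> D" "T y \<in> E" and xy: "A y = A' x"
  shows "T x \<in> E \<and> B' (T x) = B (T y)"
proof (rule M.closed')
  note core = adjoint_intertwine_core[OF N.smooth_core]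
  show "T (N.smooth i x) \<in> E" for i using core by simp
  show "(\<lambda>i. T (N.smooth i x)) \<longlonglongrightarrow> T x" by (rule T_smooth_tendsto[OF x])
  have "B' (T (N.smooth i x)) = M.smooth i (B (T y))" for i
  proof -
    have "B' (T (N.smooth i x)) = T (A (N.smooth i y))"
      using core x y xy by (simp add: N.smooth_A)
    also have "\<dots> = B (T (N.smooth i y))"
      using intertwine[of "N.smooth i y"] by (simp add: cores N.smooth_core)
    also have "\<dots> = M.smooth i (B (T y))" using y by (simp add: T_smooth M.smooth_A)
    finally show ?thesis .
  qed
  then show "(\<lambda>i. B' (T (N.smooth i x))) \<longlonglongrightarrow> B (T y)"
    using M.smooth_tendsto by simp
qed

end

theorem theorem3p3:
  fixes T M N :: "'a::chilbert_space lop"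
  assumes "closed_op T"
    and "normal_op M"
    and "normal_op N"
    and "opdom N \<subseteq> opdom T"
    and "op_le (op_comp T N) (op_comp M T)"
  shows "op_le (op_comp T (op_adjoint N)) (op_comp (op_adjoint M) T)"
proof -
  have lin: "linear_op T" using assms(1) by (simp add: closed_op_def)
  have clN: "closed_op N" using assms(3) by (simp add: normal_op_def)
  obtain C where C: "C \<ge> 0"
    "\<And>x. x \<in> opdom N \<Longrightarrow> norm (opapp T x) \<le> C * (norm x + norm (opapp N x))"
    using relatively_bounded[OF assms(1) clN assms(4)] by blast
  have TN: "opapp T x \<in> opdom M \<and> opapp M (opapp T x) = opapp T (opapp N x)"
    if "x \<in> opdom N" "opapp N x \<in> opdom T" for x
    using assms(5) that by (auto simp: op_le_def op_comp_def opdom_def opapp_def)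
  interpret N: normal_pair "opdom N" "opapp N" "opapp (op_adjoint N)"
    by (rule normal_op_imp_normal_pair[OF assms(3)])
  interpret M: normal_pair "opdom M" "opapp M" "opapp (op_adjoint M)"
    by (rule normal_op_imp_normal_pair[OF assms(2)])
  interpret intertwining "opdom N" "opapp N" "opapp (op_adjoint N)"
    "opdom M" "opapp M" "opapp (op_adjoint M)" "opapp T" C
    by unfold_locales
       (use assms(4) C TN in \<open>auto simp: linear_opD(2,3)[OF lin] subset_iff\<close>)
  have "opapp T x \<in> opdom (op_adjoint M)
      \<and> opapp (op_adjoint M) (opapp T x) = opapp T (opapp (op_adjoint N) x)"
    if x: "x \<in> opdom (op_adjoint N)" "opapp (op_adjoint N) x \<in> opdom T" for x
  proof -
    have xN: "x \<in> opdom N" using x(1) normal_op_adjoint_dom(1)[OF assms(3)] by simp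
    obtain y where y: "y \<in> opdom N" "opapp N y = opapp (op_adjoint N) x"
      using normal_op_range_adjoint_subset[OF assms(3) xN] by blast
    \<comment> \<open>As \<open>N y = N* x\<close> lies in the domain of \<open>T\<close>, the full
      hypothesis applies to \<open>y\<close> and evaluates \<open>M (T y)\<close> as
      \<open>T (N* x)\<close>.\<close>
    show ?thesis
      using adjoint_intertwine_range[OF xN y(1) _ y(2)] TN[OF y(1)] x(2) y(2)
        normal_op_adjoint_dom(1)[OF assms(2)] by simp
  qed
  moreover have "x \<in> opdom T" if "x \<in> opdom (op_adjoint N)" for x
    using that assms(4) normal_op_adjoint_dom(1)[OF assms(3)] by auto
  ultimately show ?thesis
    by (auto simp: op_le_def op_comp_def opdom_def opapp_def)
qed

end
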